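(* Let $\mathbb{X}$ be a Banach space and $1<p<\infty$. Assume that $\ell_p$ is isomorphic to a complemented subspace of $\mathbb{X}$, that $c_0$ is isomorphic to a complemented subspace of $\mathbb{X}$, and that $\mathbb{X}$ has a basis. Then $\mathbb{X}$ has a quasi-greedy basis $\mathcal{B}$ with $L_m[\mathcal{B}]\approx\log m$ for $m\ge2$.
   Context: Banach spaces are real or complex and bases are Schauder bases. Let $\mathcal{B}=(\mathbf{x}_n)_{n=1}^\infty$ be a basis of $\mathbb{X}$ with coordinate functionals $(\mathbf{x}_n^* )_{n=1}^\infty$. For $A\subseteq\mathbb{N}$, the coordinate projection is $S_A[\mathcal{B}](f)=\sum_{n\in A}\mathbf{x}_n^*(f)\,\mathbf{x}_n$ (when well defined), and $\operatorname{supp}(f)=\{n:\mathbf{x}_n^*(f)\neq0\}$. The basis is quasi-greedy if $0<\inf_j\|\mathbf{x}_j\|\le\sup_j\|\mathbf{x}_j\|<\infty$ and there is a constant $C$ such that $\|f-S_A[\mathcal{B}](f)\|\le C\|f\|$ whenever $f\in\mathbb{X}$ and $A\subseteq\mathbb{N}$ satisfy $|\mathbf{x}_j^*(f)|\le|\mathbf{x}_k^*(f)|$ for all $j\in\mathbb{N}\setminus A$ and $k\in A$. The w-conditionality constants are $$L_m[\mathcal{B}]=\sup\left\{\frac{\|S_A[\mathcal{B}](f)\|}{\|f\|}: f\ne0,\ \max(\operatorname{supp}(f))\le m,\ A\subseteq\mathbb{N}\right\}.$$ For families of nonnegative reals, $\alpha_i\lesssim\beta_i$ means there is a constant $C$ with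 $\alpha_i\le C\beta_i$ for all $i$, and $\alpha_i\approx\beta_i$ means $\alpha_i\lesssim\beta_i$ and $\beta_i\lesssim\alpha_i$. *)

theory Defs
  imports "HOL-Analysis.Analysis"
begin

text \<open>The scalar field of a Banach space is real or complex. Both cases are covered by one type
  class, whose axiom says that the field is the real line or is obtained from it by adjoining a
  square root of minus one. The norm of \<^class>\<open>real_normed_field\<close> is multiplicative, so
  it is the usual absolute value in either case.\<close>

class real_or_complex_field = real_normed_field +
  assumes real_or_complex:
    "(\<forall>z. \<exists>a. z = a *\<^sub>R 1) \<or> (\<exists>i. i * i = - 1 \<and> (\<forall>z. \<exists>a b. z = a *\<^sub>R 1 + b *\<^sub>R i))"

instance real :: real_or_complex_field
  by standard simp

instance complex :: real_or_complex_field
proof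
  have "\<i> * \<i> = - 1 \<and> (\<forall>z. \<exists>a b. z = a *\<^sub>R 1 + b *\<^sub>R \<i>)"
    by (auto simp: complex_eq_iff)
  then show "(\<forall>z::complex. \<exists>a. z = a *\<^sub>R 1) \<or>
      (\<exists>i::complex. i * i = - 1 \<and> (\<forall>z. \<exists>a b. z = a *\<^sub>R 1 + b *\<^sub>R i))"
    by blast
qed

text \<open>A Banach space over the field: completeness comes from \<^class>\<open>banach\<close>, and the
  real scalar multiplication of that class is the restriction of \<open>smul\<close> to real scalars.\<close>

locale banach_space_over = vector_space smul
  for smul :: "'k::real_or_complex_field \<Rightarrow> 'a::banach \<Rightarrow> 'a" +
  assumes norm_scale: "norm (smul c x) = norm c * norm x"
    and scale_of_real: "smul (of_real r) x = r *\<^sub>R x"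

definition bounded_linear_operator ::
    "('k::real_or_complex_field \<Rightarrow> 'a::banach \<Rightarrow> 'a) \<Rightarrow> ('a \<Rightarrow> 'a) \<Rightarrow> bool" where
  "bounded_linear_operator smul P \<longleftrightarrow>
     Vector_Spaces.linear smul smul P \<and> (\<exists>K. \<forall>x. norm (P x) \<le> K * norm x)"

definition complemented_subspace ::
    "('k::real_or_complex_field \<Rightarrow> 'a::banach \<Rightarrow> 'a) \<Rightarrow> 'a set \<Rightarrow> bool" where
  "complemented_subspace smul Y \<longleftrightarrow>
     (\<exists>P. bounded_linear_operator smul P \<and> P \<circ> P = P \<and> range P = Y)"

text \<open>Sequence spaces are given by a carrier \<open>S\<close>, a set of scalar sequences with pointwise
  operations, and a norm \<open>N\<close> on it. An isomorphism is a linear bijection that is bounded and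
  has a bounded inverse; the last condition is the second norm estimate.\<close>

definition seq_space_isomorphism ::
    "('k::real_or_complex_field \<Rightarrow> 'a::banach \<Rightarrow> 'a) \<Rightarrow> (nat \<Rightarrow> 'k) set \<Rightarrow>
     ((nat \<Rightarrow> 'k) \<Rightarrow> real) \<Rightarrow> 'a set \<Rightarrow> ((nat \<Rightarrow> 'k) \<Rightarrow> 'a) \<Rightarrow> bool" where
  "seq_space_isomorphism smul S N Y T \<longleftrightarrow>
     bij_betw T S Y \<and>
     (\<forall>a\<in>S. \<forall>b\<in>S. T (\<lambda>n. a n + b n) = T a + T b) \<and>
     (\<forall>c. \<forall>a\<in>S. T (\<lambda>n. c * a n) = smul c (T a)) \<and>
     (\<exists>K. \<forall>a\<in>S. norm (T a) \<le> K * N a) \<and>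
     (\<exists>K. \<forall>a\<in>S. N a \<le> K * norm (T a))"

definition isomorphic_to_complemented_subspace ::
    "(nat \<Rightarrow> 'k) set \<Rightarrow> ((nat \<Rightarrow> 'k) \<Rightarrow> real) \<Rightarrow>
     ('k::real_or_complex_field \<Rightarrow> 'a::banach \<Rightarrow> 'a) \<Rightarrow> bool" where
  "isomorphic_to_complemented_subspace S N smul \<longleftrightarrow>
     (\<exists>Y T. complemented_subspace smul Y \<and> seq_space_isomorphism smul S N Y T)"

definition ell :: "real \<Rightarrow> (nat \<Rightarrow> 'k::real_or_complex_field) set" where
  "ell p = {a. summable (\<lambda>n. norm (a n) powr p)}"

definition ell_norm :: "real \<Rightarrow> (nat \<Rightarrow> 'k::real_or_complex_field) \<Rightarrow> real" where
  "ell_norm p a = (\<Sum>n. norm (a n) powr p) powr (1 / p)"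

definition c_null :: "(nat \<Rightarrow> 'k::real_or_complex_field) set" where
  "c_null = {a. a \<longlonglongrightarrow> 0}"

definition c_null_norm :: "(nat \<Rightarrow> 'k::real_or_complex_field) \<Rightarrow> real" where
  "c_null_norm a = (SUP n. norm (a n))"

text \<open>Bases are indexed from zero: \<open>x n\<close> is the basis vector with number \<open>n + 1\<close>.\<close>

definition schauder_basis ::
    "('k::real_or_complex_field \<Rightarrow> 'a::banach \<Rightarrow> 'a) \<Rightarrow> (nat \<Rightarrow> 'a) \<Rightarrow> bool" where
  "schauder_basis smul x \<longleftrightarrow> (\<forall>f. \<exists>!a. (\<lambda>n. smul (a n) (x n)) sums f)"

definition coord ::
    "('k::real_or_complex_field \<Rightarrow> 'a::banach \<Rightarrow> 'a) \<Rightarrow> (nat \<Rightarrow> 'a) \<Rightarrow> nat \<Rightarrow> 'a \<Rightarrow> 'k" where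
  "coord smul x n f = (THE a. (\<lambda>n. smul (a n) (x n)) sums f) n"

definition supp ::
    "('k::real_or_complex_field \<Rightarrow> 'a::banach \<Rightarrow> 'a) \<Rightarrow> (nat \<Rightarrow> 'a) \<Rightarrow> 'a \<Rightarrow> nat set" where
  "supp smul x f = {n. coord smul x n f \<noteq> 0}"

text \<open>This is meaningful only where the series converges. That is automatic in both uses below:
  in \<open>w_cond\<close> the vector has finite support; in \<open>quasi_greedy_basis\<close> the coordinates
  tend to zero because the basis is bounded away from zero, so \<open>A\<close> is finite or contains the
  support.\<close>

definition coord_proj ::
    "('k::real_or_complex_field \<Rightarrow> 'a::banach \<Rightarrow> 'a) \<Rightarrow> (nat \<Rightarrow> 'a) \<Rightarrow> nat set \<Rightarrow> 'a \<Rightarrow> 'a" where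
  "coord_proj smul x A f = (\<Sum>n. if n \<in> A then smul (coord smul x n f) (x n) else 0)"

definition quasi_greedy_basis ::
    "('k::real_or_complex_field \<Rightarrow> 'a::banach \<Rightarrow> 'a) \<Rightarrow> (nat \<Rightarrow> 'a) \<Rightarrow> bool" where
  "quasi_greedy_basis smul x \<longleftrightarrow>
     schauder_basis smul x \<and>
     0 < (INF j. norm (x j)) \<and> bdd_above (range (\<lambda>j. norm (x j))) \<and>
     (\<exists>C. \<forall>f A. (\<forall>j\<in>-A. \<forall>k\<in>A. norm (coord smul x j f) \<le> norm (coord smul x k f)) \<longrightarrow>
        norm (f - coord_proj smul x A f) \<le> C * norm f)"

text \<open>With indexing from zero, a support whose maximal element is at most \<open>m\<close> in the
  indexing from one is a subset of \<open>{..<m}\<close>. For a Schauder basis and \<open>m \<ge> 1\<close>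
  the supremum is over a nonempty bounded set, since the vectors concerned form a
  finite-dimensional space.\<close>

definition w_cond ::
    "('k::real_or_complex_field \<Rightarrow> 'a::banach \<Rightarrow> 'a) \<Rightarrow> (nat \<Rightarrow> 'a) \<Rightarrow> nat \<Rightarrow> real" where
  "w_cond smul x m =
     Sup {norm (coord_proj smul x A f) / norm f | f A. f \<noteq> 0 \<and> supp smul x f \<subseteq> {..<m}}"

definition dominated_on :: "'i set \<Rightarrow> ('i \<Rightarrow> real) \<Rightarrow> ('i \<Rightarrow> real) \<Rightarrow> bool" where
  "dominated_on I \<alpha> \<beta> \<longleftrightarrow> (\<exists>C. \<forall>i\<in>I. \<alpha> i \<le> C * \<beta> i)"

definition equivalent_on :: "'i set \<Rightarrow> ('i \<Rightarrow> real) \<Rightarrow> ('i \<Rightarrow> real) \<Rightarrow> bool" where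
  "equivalent_on I \<alpha> \<beta> \<longleftrightarrow> dominated_on I \<alpha> \<beta> \<and> dominated_on I \<beta> \<alpha>"

end

theory Submission
  imports Defs
begin

text \<open>The construction follows Dilworth, Kalton and Kutzarova. Absorbing a second copy of \<open>c_null\<close>
  gives the space a basis \<open>z\<close> in which the given basis alternates with the summing basis of
  \<open>c_null\<close>; projections then have norms growing linearly on the span of the first \<open>K\<close> vectors.
  Next, \<open>ell p\<close> is the sum of the sequences that are constant on dyadic blocks, again a copy of
  \<open>ell p\<close>, and of those with mean zero on each block. Hence the whole space is isomorphic to its
  direct sum with the latter, and block \<open>n\<close> of mean-zero sequences, of dimension \<open>2 ^ n - 1\<close>, can be
  combined with the single vector \<open>z n\<close> into \<open>2 ^ n\<close> new basis vectors. Spreading \<open>z n\<close> evenly makes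
  its influence on individual coefficients small compared with the \<open>ell p\<close> norm, which gives
  quasi-greediness, and the dyadic block lengths turn linear growth in the number of vectors
  \<open>z n\<close> into logarithmic growth in the number of new basis vectors.\<close>

subsection \<open>Partial sums of Schauder bases\<close>

text \<open>The obstacle is that \<open>z\<close> is badly conditional, yet greedy sums of the new
  basis must stay bounded. What reconciles the two is scale. \<open>weight p n\<close> = 2^(n/p) is
  the \<open>ell p\<close> norm of the indicator of block \<open>n\<close>, and a coordinate c on
  \<open>z n\<close> is seen in the new basis as coefficients with mean c /
  \<open>weight p n\<close> on that block. A greedy threshold t can therefore be dominated by the
  mean part only on blocks with \<open>t * weight p n\<close> at most a multiple of
  \<open>norm f\<close>; coefficients below t on those blocks add up geometrically, so the triangle
  inequality suffices for the vectors \<open>z n\<close>. Inside a single block, the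
  \<open>ell p\<close> norm of the coefficients is bounded by the vector, and the norm of a
  combination by the \<open>ell p\<close> norm of its coefficients, uniformly in \<open>n\<close>. A
  projection within a block thus costs a constant, and counting blocks gives the upper bound by log
  m. Conversely, a projection onto whole blocks acts on the range of \<open>emb\<close> as the
  corresponding projection for \<open>z\<close>, which carries over the linear growth.\<close>

lemma closed_cover_interior:
  fixes E :: "nat \<Rightarrow> 'b::complete_space set"
  assumes "(\<Union>k. E k) = UNIV"
  obtains k where "interior (closure (E k)) \<noteq> {}"
proof (rule ccontr)
  assume "\<not> thesis"
  then have empty: "interior (closure (E k)) = {}" for k
    using that by blast
  have "euclidean interior_of \<Union>(range (\<lambda>k. closure (E k))) = {}"
    by (rule Baire_category_alt) (auto simp: completely_metrizable_space_euclidean empty)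
  moreover have "\<Union>(range (\<lambda>k. closure (E k))) = UNIV"
    using assms closure_subset by blast
  ultimately show False by simp
qed

text \<open>Multiplying by the conjugate \<open>a - b i\<close> gives the real number a^2 + b^2, and
  the norm is multiplicative. The conjugate is estimated by |a| + |b| only, and (|a| + |b|)^2 \<le>
  2 (a^2 + b^2) yields the constant 2.\<close>

lemma adjoin_imaginary_unit_norm_bounds:
  fixes i :: "'k::real_or_complex_field"
  assumes "i * i = - 1"
  shows "\<bar>a\<bar> \<le> 2 * norm (a *\<^sub>R 1 + b *\<^sub>R i)" and "\<bar>b\<bar> \<le> 2 * norm (a *\<^sub>R 1 + b *\<^sub>R i)"
proof -
  have "norm i * norm i = 1"
    by (metis assms norm_minus_cancel norm_mult norm_one)
  then have ni: "norm i = 1"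
    by (metis abs_norm_cancel abs_square_eq_1 power2_eq_square)
  have "(a *\<^sub>R 1 + b *\<^sub>R i) * (a *\<^sub>R 1 - b *\<^sub>R i) = a\<^sup>2 *\<^sub>R 1 - b\<^sup>2 *\<^sub>R (i * i)"
    by (simp add: algebra_simps power2_eq_square)
  also have "\<dots> = of_real (a\<^sup>2 + b\<^sup>2)"
    by (simp add: assms of_real_def scaleR_add_left)
  finally have "norm (a *\<^sub>R 1 + b *\<^sub>R i) * norm (a *\<^sub>R 1 - b *\<^sub>R i) = a\<^sup>2 + b\<^sup>2"
    by (metis norm_mult norm_of_real abs_of_nonneg sum_power2_ge_zero)
  moreover have "norm (a *\<^sub>R 1 - b *\<^sub>R i) \<le> \<bar>a\<bar> + \<bar>b\<bar>"
    using norm_triangle_ineq4[of "a *\<^sub>R 1" "b *\<^sub>R i"] ni by simp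
  ultimately have le: "a\<^sup>2 + b\<^sup>2 \<le> norm (a *\<^sub>R 1 + b *\<^sub>R i) * (\<bar>a\<bar> + \<bar>b\<bar>)"
    by (metis mult_left_mono norm_ge_zero)
  define s where "s = \<bar>a\<bar> + \<bar>b\<bar>"
  have "s\<^sup>2 \<le> 2 * (a\<^sup>2 + b\<^sup>2)"
    using sum_squares_bound[of "\<bar>a\<bar>" "\<bar>b\<bar>"] by (simp add: s_def power2_sum)
  then have "s * s \<le> (2 * norm (a *\<^sub>R 1 + b *\<^sub>R i)) * s"
    using le by (simp add: s_def power2_eq_square)
  then have "s \<le> 2 * norm (a *\<^sub>R 1 + b *\<^sub>R i)"
    using mult_right_le_imp_le[of s s "2 * norm (a *\<^sub>R 1 + b *\<^sub>R i)"] norm_ge_zero[of "a *\<^sub>R 1 + b *\<^sub>R i"]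
    by (cases "s > 0") linarith+
  then show "\<bar>a\<bar> \<le> 2 * norm (a *\<^sub>R 1 + b *\<^sub>R i)" "\<bar>b\<bar> \<le> 2 * norm (a *\<^sub>R 1 + b *\<^sub>R i)"
    by (simp_all add: s_def)
qed

text \<open>The scalar class does not postulate completeness; it is inherited from the reals through
  the coefficients. It is what allows limits of coordinates to be taken in
  \<open>psum_bounded\<close>.\<close>

lemma real_or_complex_field_complete:
  fixes X :: "nat \<Rightarrow> 'k::real_or_complex_field"
  assumes "Cauchy X"
  shows "convergent X"
proof -
  consider "\<forall>z::'k. \<exists>a. z = a *\<^sub>R 1"
    | i :: 'k where "i * i = - 1" "\<forall>z::'k. \<exists>a b. z = a *\<^sub>R 1 + b *\<^sub>R i"
    using real_or_complex[where 'a='k] by blast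
  then show ?thesis
  proof cases
    case 1
    then obtain a where a: "\<And>z::'k. z = a z *\<^sub>R 1" by metis
    have "norm (X m - X n) = norm (a (X m) - a (X n))" for m n
      by (metis a norm_of_real of_real_def real_norm_def scaleR_left_diff_distrib)
    then have "Cauchy (\<lambda>n. a (X n))"
      using assms unfolding Cauchy_def dist_norm by presburger
    then obtain l where "(\<lambda>n. a (X n)) \<longlonglongrightarrow> l"
      using real_Cauchy_convergent convergent_def by blast
    then have "(\<lambda>n. a (X n) *\<^sub>R (1::'k)) \<longlonglongrightarrow> l *\<^sub>R 1"
      by (intro tendsto_intros)
    then have "X \<longlonglongrightarrow> l *\<^sub>R 1"
      using a by simp
    then show ?thesis by (auto simp: convergent_def)
  next
    case 2
    then obtain a b where ab: "\<And>z::'k. z = a z *\<^sub>R 1 + b z *\<^sub>R i" by metis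
    \<comment> \<open>The chosen functions \<open>a\<close> and \<open>b\<close> are not known to be
      additive, so the norm bounds are applied to the difference of two chosen
      representations.\<close>
    have diff: "X m - X n = (a (X m) - a (X n)) *\<^sub>R 1 + (b (X m) - b (X n)) *\<^sub>R i" for m n
      using ab[of "X m"] ab[of "X n"] by (metis add_diff_add scaleR_left_diff_distrib)
    have na: "norm (a (X m) - a (X n)) \<le> 2 * norm (X m - X n)" for m n
      unfolding diff using adjoin_imaginary_unit_norm_bounds(1)[OF 2(1)] by simp
    have nb: "norm (b (X m) - b (X n)) \<le> 2 * norm (X m - X n)" for m n
      unfolding diff using adjoin_imaginary_unit_norm_bounds(2)[OF 2(1)] by simp
    have conv: "convergent g" if "\<And>m n. norm (g m - g n) \<le> 2 * norm (X m - X n)" for g :: "nat \<Rightarrow> real"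
    proof (rule real_Cauchy_convergent, rule metric_CauchyI)
      fix e :: real assume "e > 0"
      then obtain M where "\<forall>m\<ge>M. \<forall>n\<ge>M. norm (X m - X n) < e / 2"
        using assms by (metis CauchyD half_gt_zero)
      then show "\<exists>M. \<forall>m\<ge>M. \<forall>n\<ge>M. dist (g m) (g n) < e"
        using that by (intro exI[of _ M]) (smt (verit) dist_norm field_sum_of_halves)
    qed
    obtain l where "(\<lambda>n. a (X n)) \<longlonglongrightarrow> l"
      using conv[OF na] convergent_def by blast
    moreover obtain l' where "(\<lambda>n. b (X n)) \<longlonglongrightarrow> l'"
      using conv[OF nb] convergent_def by blast
    ultimately have "(\<lambda>n. a (X n) *\<^sub>R 1 + b (X n) *\<^sub>R i) \<longlonglongrightarrow> l *\<^sub>R 1 + l' *\<^sub>R i"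
      by (intro tendsto_intros)
    then have "X \<longlonglongrightarrow> l *\<^sub>R 1 + l' *\<^sub>R i"
      by (simp flip: ab)
    then show ?thesis by (auto simp: convergent_def)
  qed
qed

context banach_space_over
begin

sublocale smul: bounded_bilinear smul
proof
  show "smul (r *\<^sub>R c) x = r *\<^sub>R smul c x" for r c x
    by (metis scale_of_real scale_scale scaleR_conv_of_real)
  show "smul c (r *\<^sub>R x) = r *\<^sub>R smul c x" for r c x
    by (metis scale_of_real scale_left_commute)
  show "\<exists>K. \<forall>c x. norm (smul c x) \<le> norm c * norm x * K"
    by (intro exI[of _ 1]) (simp add: norm_scale)
qed (simp_all add: scale_right_distrib scale_left_distrib)

lemma coord_eqI:
  assumes "schauder_basis smul x" "(\<lambda>n. smul (a n) (x n)) sums f"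
  shows "coord smul x n f = a n"
  unfolding coord_def using assms unfolding schauder_basis_def
  by (metis (mono_tags, lifting) the1_equality)

lemma coord_sums:
  assumes "schauder_basis smul x"
  shows "(\<lambda>n. smul (coord smul x n f) (x n)) sums f"
proof -
  obtain a where a: "(\<lambda>n. smul (a n) (x n)) sums f"
    using assms unfolding schauder_basis_def by blast
  then show ?thesis using coord_eqI[OF assms a] by simp
qed

lemma coord_add:
  assumes "schauder_basis smul x"
  shows "coord smul x n (f + g) = coord smul x n f + coord smul x n g"
  by (rule coord_eqI[OF assms], unfold scale_left_distrib)
    (intro sums_add coord_sums assms)

lemma coord_scale:
  assumes "schauder_basis smul x"
  shows "coord smul x n (smul c f) = c * coord smul x n f"
proof (rule coord_eqI[OF assms])
  show "(\<lambda>n. smul (c * coord smul x n f) (x n)) sums smul c f"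
    using bounded_linear.sums[OF smul.bounded_linear_right coord_sums[OF assms]]
    by (simp flip: scale_scale)
qed

lemma coord_basis:
  assumes "schauder_basis smul x"
  shows "coord smul x n (x m) = (if n = m then 1 else 0)"
proof (rule coord_eqI[OF assms])
  show "(\<lambda>n. smul (if n = m then 1 else 0) (x n)) sums x m"
    using sums_single[of m x] by (simp add: if_distrib[of "\<lambda>c. smul c _"] cong: if_cong)
qed

lemma coord_diff:
  assumes "schauder_basis smul x"
  shows "coord smul x n (f - g) = coord smul x n f - coord smul x n g"
  by (metis add_diff_cancel assms coord_add diff_add_cancel)

lemma coord_zero:
  assumes "schauder_basis smul x"
  shows "coord smul x n 0 = 0"
  using coord_diff[OF assms, of n 0 0] by simp

lemma basis_vector_nonzero:
  assumes "schauder_basis smul x"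
  shows "x n \<noteq> 0"
  using coord_basis[OF assms, of n n] coord_zero[OF assms, of n] by auto

section \<open>Uniform boundedness of the partial sum operators\<close>

definition psum :: "(nat \<Rightarrow> 'a) \<Rightarrow> nat \<Rightarrow> 'a \<Rightarrow> 'a" where
  "psum x N f = (\<Sum>n<N. smul (coord smul x n f) (x n))"

lemma psum_diff:
  assumes "schauder_basis smul x"
  shows "psum x N (f - g) = psum x N f - psum x N g"
  by (simp add: psum_def coord_diff[OF assms] scale_left_diff_distrib sum_subtractf)

lemma psum_scale:
  assumes "schauder_basis smul x"
  shows "psum x N (smul c f) = smul c (psum x N f)"
  by (simp add: psum_def coord_scale[OF assms] scale_sum_right)

lemma psum_tendsto:
  assumes "schauder_basis smul x"
  shows "(\<lambda>N. psum x N f) \<longlonglongrightarrow> f"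
  using coord_sums[OF assms] unfolding sums_def psum_def .

text \<open>Baire's theorem makes the vectors with uniformly controlled partial sums dense; this is the
  first half of the open mapping theorem for the norm \<open>SUP N. norm (psum x N f)\<close>.\<close>

lemma psum_bounded_approximation:
  assumes "schauder_basis smul x"
  obtains K where "K \<ge> 0" "\<And>f e. e > 0 \<Longrightarrow> \<exists>g. norm (f - g) < e \<and> (\<forall>N. norm (psum x N g) \<le> K * norm f)"
proof -
  define E where "E k = {f. \<forall>N. norm (psum x N f) \<le> real k}" for k :: nat
  have "f \<in> (\<Union>k. E k)" for f
  proof -
    obtain B where B: "\<And>N. norm (psum x N f) \<le> B"
      using psum_tendsto[OF assms, of f] convergent_def convergent_imp_Bseq Bseq_def by metis
    obtain k :: nat where "B \<le> real k" using real_arch_simple by blast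
    then have "f \<in> E k" using B order_trans unfolding E_def by blast
    then show ?thesis by blast
  qed
  then have "(\<Union>k. E k) = UNIV" by blast
  then obtain k where "interior (closure (E k)) \<noteq> {}" by (rule closed_cover_interior)
  then obtain c r where r: "r > 0" "ball c r \<subseteq> closure (E k)"
    by (metis all_not_in_conv mem_interior)
  \<comment> \<open>Both \<open>c + f\<close> and \<open>c\<close> lie in the closure of
    \<open>E k\<close>. Subtracting approximants of the two moves the ball to the origin and doubles
    the bound.\<close>
  have small: "\<exists>g. norm (f - g) < e \<and> (\<forall>N. norm (psum x N g) \<le> 2 * k)"
    if "norm f < r" "e > 0" for f e
  proof -
    have "c + f \<in> closure (E k)" "c \<in> closure (E k)"
      using that r by (auto simp: dist_norm)
    then obtain g h where gh: "g \<in> E k" "dist g (c + f) < e/2" "h \<in> E k" "dist h c < e/2"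
      using \<open>e > 0\<close> unfolding closure_approachable by (meson half_gt_zero)
    have "f - (g - h) = (h - c) - (g - (c + f))" by simp
    then have "norm (f - (g - h)) \<le> norm (h - c) + norm (g - (c + f))"
      by (metis norm_triangle_ineq4)
    then have "norm (f - (g - h)) < e" using gh by (simp add: dist_norm)
    moreover have "norm (psum x N (g - h)) \<le> 2 * k" for N
    proof -
      have "norm (psum x N g) \<le> k" "norm (psum x N h) \<le> k" using gh by (auto simp: E_def)
      then show ?thesis
        using norm_triangle_ineq4[of "psum x N g" "psum x N h"] by (simp add: psum_diff[OF assms])
    qed
    ultimately show ?thesis by blast
  qed
  show thesis
  proof (rule that[of "4 * k / r"])
    show "4 * k / r \<ge> 0" using r by simp
    fix f and e :: real assume e: "e > 0"
    show "\<exists>g. norm (f - g) < e \<and> (\<forall>N. norm (psum x N g) \<le> 4 * k / r * norm f)"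
    proof (cases "f = 0")
      case True
      then show ?thesis
        using e by (intro exI[of _ 0]) (simp add: psum_def coord_zero[OF assms])
    next
      case False
      define s where "s = r / (2 * norm f)"
      have s: "s > 0" using False r by (simp add: s_def)
      have "norm (s *\<^sub>R f) < r" using False r by (simp add: s_def)
      then obtain g where g: "norm (s *\<^sub>R f - g) < s * e" "\<And>N. norm (psum x N g) \<le> 2 * k"
        using small[of "s *\<^sub>R f" "s * e"] s e by auto
      define g' where "g' = inverse s *\<^sub>R g"
      have "s *\<^sub>R (f - g') = s *\<^sub>R f - g" using s by (simp add: g'_def algebra_simps)
      then have "s * norm (f - g') < s * e" by (metis g(1) norm_scaleR abs_of_pos s)
      then have "norm (f - g') < e" using s by simp
      moreover have "norm (psum x N g') \<le> 4 * k / r * norm f" for N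
      proof -
        have "psum x N g' = inverse s *\<^sub>R psum x N g"
          unfolding g'_def by (metis psum_scale[OF assms] scale_of_real)
        then have "norm (psum x N g') \<le> inverse s * (2 * k)"
          using s g(2)[of N] by simp
        also have "\<dots> = 4 * k / r * norm f" using r False by (simp add: s_def field_simps)
        finally show ?thesis .
      qed
      ultimately show ?thesis by blast
    qed
  qed
qed

text \<open>Successive approximation: \<open>f\<close> is a sum of approximants whose partial sums
  decay geometrically, uniformly in \<open>N\<close>. Continuity of the coordinates is not yet
  available, so the coordinates of the finite sums \<open>s i\<close> are shown to be Cauchy, their
  limits are shown to expand \<open>f\<close>, and uniqueness of the expansion identifies them with
  the coordinates of \<open>f\<close>.\<close>

theorem psum_bounded:
  assumes "schauder_basis smul x"
  shows "\<exists>K\<ge>0. \<forall>N f. norm (psum x N f) \<le> K * norm f"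
proof -
  obtain K where K: "K \<ge> 0"
    "\<And>f e. e > 0 \<Longrightarrow> \<exists>g. norm (f - g) < e \<and> (\<forall>N. norm (psum x N g) \<le> K * norm f)"
    using psum_bounded_approximation[OF assms] by blast
  have "norm (psum x N f) \<le> 2 * K * norm f" for N f
  proof (cases "f = 0")
    case True
    then show ?thesis by (simp add: psum_def coord_zero[OF assms])
  next
    case False
    define d where "d i = norm f * (1/2)^i" for i
    have d: "d i > 0" for i using False by (simp add: d_def)
    define G where "G g e = (SOME h. norm (g - h) < e \<and> (\<forall>N. norm (psum x N h) \<le> K * norm g))" for g e
    have "norm (g - G g e) < e \<and> (\<forall>N. norm (psum x N (G g e)) \<le> K * norm g)" if "e > 0" for g e
      unfolding G_def by (rule someI_ex[OF K(2)[OF that]])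
    then have G: "norm (g - G g e) < e" "norm (psum x N (G g e)) \<le> K * norm g" if "e > 0" for g e N
      using that by blast+
    \<comment> \<open>\<open>R i\<close> is the remainder after \<open>i\<close> approximants. Each
      new one leaves an error below \<open>d (Suc i)\<close>, so the bound on the remainder halves,
      while the partial sums of the removed piece are at most \<open>K * d i\<close>.\<close>
    define R where "R = rec_nat f (\<lambda>i g. g - G g (d (Suc i)))"
    have R0: "R 0 = f" and RS: "R (Suc i) = R i - G (R i) (d (Suc i))" for i
      by (simp_all add: R_def)
    have Rn: "norm (R i) \<le> d i" for i
    proof (cases i)
      case (Suc j)
      then show ?thesis using G(1)[OF d, of "R j" "Suc j"] by (simp add: RS)
    qed (simp add: R0 d_def)
    have step: "norm (psum x N (R i) - psum x N (R (Suc i))) \<le> K * d i" for i N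
    proof -
      have "psum x N (R i) - psum x N (R (Suc i)) = psum x N (G (R i) (d (Suc i)))"
        by (simp add: RS flip: psum_diff[OF assms])
      then show ?thesis
        using G(2)[OF d, of N "R i" "Suc i"] mult_left_mono[OF Rn[of i] K(1)] by simp
    qed
    have far: "norm (psum x N (R i) - psum x N (R (i + j))) \<le> 2 * K * (d i - d (i + j))" for i j N
    proof (induction j)
      case (Suc j)
      have "norm (psum x N (R i) - psum x N (R (i + Suc j)))
          \<le> norm (psum x N (R i) - psum x N (R (i + j)))
            + norm (psum x N (R (i + j)) - psum x N (R (Suc (i + j))))"
        using norm_triangle_ineq[of "psum x N (R i) - psum x N (R (i + j))"
            "psum x N (R (i + j)) - psum x N (R (Suc (i + j)))"] by simp
      also have "\<dots> \<le> 2 * K * (d i - d (i + j)) + K * d (i + j)"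
        using Suc step by (intro add_mono)
      also have "\<dots> = 2 * K * (d i - d (i + Suc j))"
        by (simp add: d_def algebra_simps)
      finally show ?case .
    qed simp
    have dlim: "d \<longlonglongrightarrow> 0"
      unfolding d_def by (intro tendsto_mult_right_zero LIMSEQ_power_zero) simp
    have tail: "norm (psum x N (R i) - psum x N (R j)) \<le> 2 * K * d i" if "i \<le> j" for i j N
    proof -
      have "2 * K * (d i - d j) \<le> 2 * K * d i"
        using K(1) d[of j] by (intro mult_left_mono) auto
      then show ?thesis using far[of N i "j - i"] that by simp
    qed
    define s where "s i = f - R i" for i
    have ps: "psum x N (s i) - psum x N (s j) = psum x N (R j) - psum x N (R i)" for N i j
      by (simp add: s_def psum_diff[OF assms])
    have Rlim: "R \<longlonglongrightarrow> 0"
      by (rule Lim_null_comparison[OF _ dlim]) (simp add: Rn)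
    have "Cauchy (\<lambda>i. coord smul x n (s i))" for n
    proof (rule metric_CauchyI)
      fix e :: real assume e: "e > 0"
      have xn: "norm (x n) > 0" using basis_vector_nonzero[OF assms] by simp
      \<comment> \<open>The 4 is twice the 2 in \<open>tail\<close>: one coordinate is isolated by
        two consecutive partial sums.\<close>
      have "(\<lambda>i. 4 * K * d i) \<longlonglongrightarrow> 0" by (intro tendsto_mult_right_zero dlim)
      then have "eventually (\<lambda>i. 4 * K * d i < e/2 * norm (x n)) sequentially"
        by (rule order_tendstoD(2)) (use e xn in simp)
      then obtain M where M: "4 * K * d M < e/2 * norm (x n)"
        using eventually_happens trivial_limit_sequentially by blast
      have near: "dist (coord smul x n (s i)) (coord smul x n (s M)) < e/2" if "i \<ge> M" for i
      proof -
        have "smul (coord smul x n (s i) - coord smul x n (s M)) (x n)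
            = (psum x (Suc n) (s i) - psum x (Suc n) (s M)) - (psum x n (s i) - psum x n (s M))"
          by (simp add: psum_def scale_left_diff_distrib)
        then have "norm (coord smul x n (s i) - coord smul x n (s M)) * norm (x n)
            \<le> norm (psum x (Suc n) (s i) - psum x (Suc n) (s M)) + norm (psum x n (s i) - psum x n (s M))"
          by (metis norm_scale norm_triangle_ineq4)
        also have "\<dots> \<le> 2 * K * d M + 2 * K * d M"
          unfolding ps using tail[OF that] by (intro add_mono)
        also have "\<dots> < e/2 * norm (x n)" using M by simp
        finally show ?thesis using xn by (simp add: dist_norm)
      qed
      show "\<exists>M. \<forall>i\<ge>M. \<forall>j\<ge>M. dist (coord smul x n (s i)) (coord smul x n (s j)) < e"
        using near by (meson dist_triangle_half_l)
    qed
    then have "\<exists>l. (\<lambda>i. coord smul x n (s i)) \<longlonglongrightarrow> l" for n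
      using real_or_complex_field_complete convergent_def by blast
    then obtain a where a: "\<And>n. (\<lambda>i. coord smul x n (s i)) \<longlonglongrightarrow> a n" by metis
    define F where "F N = (\<Sum>n<N. smul (a n) (x n))" for N
    have F: "(\<lambda>i. psum x N (s i)) \<longlonglongrightarrow> F N" for N
      unfolding psum_def F_def by (intro tendsto_sum smul.tendsto a tendsto_const)
    have close: "norm (F N - psum x N (s i)) \<le> 2 * K * d i" for N i
    proof (rule LIMSEQ_le_const2)
      show "(\<lambda>j. norm (psum x N (s j) - psum x N (s i))) \<longlonglongrightarrow> norm (F N - psum x N (s i))"
        by (intro tendsto_intros F)
      show "\<exists>M. \<forall>j\<ge>M. norm (psum x N (s j) - psum x N (s i)) \<le> 2 * K * d i"
        unfolding ps using tail by blast
    qed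
    have "F \<longlonglongrightarrow> f"
    proof (rule metric_LIMSEQ_I)
      fix e :: real assume e: "e > 0"
      have "(\<lambda>i. 2 * K * d i + d i) \<longlonglongrightarrow> 0 + 0"
        by (intro tendsto_add tendsto_mult_right_zero dlim)
      then have "eventually (\<lambda>i. 2 * K * d i + d i < e/2) sequentially"
        by (rule order_tendstoD(2)) (use e in simp)
      then obtain i where i: "2 * K * d i + d i < e/2"
        using eventually_happens trivial_limit_sequentially by blast
      have "eventually (\<lambda>N. dist (psum x N (s i)) (s i) < e/2) sequentially"
        using psum_tendsto[OF assms] e by (intro tendstoD) simp_all
      then obtain M where M: "\<And>N. N \<ge> M \<Longrightarrow> norm (psum x N (s i) - s i) < e/2"
        unfolding eventually_sequentially dist_norm by blast
      have "norm (F N - f) < e" if "N \<ge> M" for N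
      proof -
        have "F N - f = (F N - psum x N (s i)) + (psum x N (s i) - s i) - R i"
          by (simp add: s_def)
        then have "norm (F N - f) \<le> norm (F N - psum x N (s i)) + norm (psum x N (s i) - s i) + norm (R i)"
          by (metis (no_types) norm_triangle_ineq norm_triangle_ineq4 add_right_mono order_trans)
        then show ?thesis using close[of N i] M[OF that] Rn[of i] i by linarith
      qed
      then show "\<exists>M. \<forall>N\<ge>M. dist (F N) f < e" by (auto simp: dist_norm)
    qed
    then have "coord smul x n f = a n" for n
      by (intro coord_eqI[OF assms]) (simp add: sums_def flip: F_def)
    then have "psum x N f = F N" by (simp add: psum_def F_def)
    moreover have "psum x N (s 0) = 0" by (simp add: s_def R0 psum_def coord_zero[OF assms])
    ultimately show ?thesis using close[of N 0] by (simp add: d_def)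
  qed
  then show ?thesis using K(1) by (intro exI[of _ "2 * K"]) simp
qed

end

subsection \<open>Biorthogonal systems and complemented copies of sequence spaces\<close>
context banach_space_over
begin

lemma bounded_linear_operatorI:
  assumes "\<And>f g. P (f + g) = P f + P g" "\<And>c f. P (smul c f) = smul c (P f)"
    "\<And>f. norm (P f) \<le> K * norm f"
  shows "bounded_linear_operator smul P"
  unfolding bounded_linear_operator_def using assms
  by (intro conjI exI[of _ K] linear_module_homI module_hom.intro module_hom_axioms.intro)
     (auto simp: module_axioms)

lemma
  assumes "bounded_linear_operator smul P"
  shows bounded_linear_operator_add: "P (f + g) = P f + P g"
    and bounded_linear_operator_scale: "P (smul c f) = smul c (P f)"
    and bounded_linear_operator_imp: "bounded_linear P"
proof -
  interpret P: module_hom smul smul P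
    using assms unfolding bounded_linear_operator_def by (simp add: module_hom_iff_linear)
  show add: "P (f + g) = P f + P g" for f g by (rule P.add)
  show scale: "P (smul c f) = smul c (P f)" for c f by (rule P.scale)
  obtain K where "\<And>x. norm (P x) \<le> K * norm x"
    using assms unfolding bounded_linear_operator_def by blast
  then show "bounded_linear P"
    by (intro bounded_linear_intro[of P K]) (auto simp: add scale mult.commute simp flip: scale_of_real)
qed

definition bounded_functional :: "('a \<Rightarrow> 'k) \<Rightarrow> bool" where
  "bounded_functional \<phi> \<longleftrightarrow> (\<forall>f g. \<phi> (f + g) = \<phi> f + \<phi> g) \<and> (\<forall>c f. \<phi> (smul c f) = c * \<phi> f) \<and>
     (\<exists>K. \<forall>f. norm (\<phi> f) \<le> K * norm f)"

lemma
  assumes "bounded_functional \<phi>"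
  shows bounded_functional_scale: "\<phi> (smul c f) = c * \<phi> f"
    and bounded_functional_imp: "bounded_linear \<phi>"
proof -
  have add: "\<phi> (f + g) = \<phi> f + \<phi> g" for f g
    using assms by (auto simp: bounded_functional_def)
  show scale: "\<phi> (smul c f) = c * \<phi> f" for c f
    using assms by (auto simp: bounded_functional_def)
  obtain K where "\<And>x. norm (\<phi> x) \<le> K * norm x"
    using assms unfolding bounded_functional_def by blast
  then show "bounded_linear \<phi>"
    by (intro bounded_linear_intro[of \<phi> K])
      (auto simp: add scale mult.commute scaleR_conv_of_real simp flip: scale_of_real)
qed

lemma biorthogonal_schauder_basis:
  assumes \<phi>: "\<And>n. bounded_functional (\<phi> n)"
    and biorth: "\<And>n m. \<phi> n (x m) = (if n = m then 1 else 0)"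
    and sums: "\<And>f. (\<lambda>n. smul (\<phi> n f) (x n)) sums f"
  shows "schauder_basis smul x" and "coord smul x n f = \<phi> n f"
proof -
  have "a n = \<phi> n f" if "(\<lambda>n. smul (a n) (x n)) sums f" for a n f
  proof -
    have "(\<lambda>m. \<phi> n (smul (a m) (x m))) sums \<phi> n f"
      by (rule bounded_linear.sums[OF bounded_functional_imp[OF \<phi>] that])
    then have "(\<lambda>m. if m = n then a m else 0) sums \<phi> n f"
      by (simp add: bounded_functional_scale[OF \<phi>] biorth if_distrib eq_commute cong: if_cong)
    then show ?thesis using sums_single[of n a] sums_unique2 by blast
  qed
  then have uniq: "a = (\<lambda>n. \<phi> n f)" if "(\<lambda>n. smul (a n) (x n)) sums f" for a f
    using that by blast
  show basis: "schauder_basis smul x"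
    unfolding schauder_basis_def
    by (rule allI, rule ex1I[of "\<lambda>a. (\<lambda>n. smul (a n) (x n)) sums _" "\<lambda>n. \<phi> n _", OF sums uniq])
  show "coord smul x n f = \<phi> n f"
    by (rule coord_eqI[OF basis sums])
qed

lemma coord_bounded:
  assumes "schauder_basis smul x"
  shows "\<exists>K\<ge>0. \<forall>n f. norm (coord smul x n f) * norm (x n) \<le> K * norm f"
proof -
  obtain K where K: "K \<ge> 0" "\<And>N f. norm (psum x N f) \<le> K * norm f"
    using psum_bounded[OF assms] by blast
  have "norm (coord smul x n f) * norm (x n) \<le> 2 * K * norm f" for n f
  proof -
    have "smul (coord smul x n f) (x n) = psum x (Suc n) f - psum x n f"
      by (simp add: psum_def)
    then have "norm (coord smul x n f) * norm (x n) = norm (psum x (Suc n) f - psum x n f)"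
      by (metis norm_scale)
    then show ?thesis
      using norm_triangle_ineq4[of "psum x (Suc n) f" "psum x n f"] K(2)[of "Suc n" f] K(2)[of n f]
      by linarith
  qed
  then show ?thesis using K(1) by (intro exI[of _ "2 * K"]) simp
qed

lemma coord_functional:
  assumes "schauder_basis smul x"
  shows "bounded_functional (coord smul x n)"
proof -
  obtain K where K: "K \<ge> 0" "\<And>n f. norm (coord smul x n f) * norm (x n) \<le> K * norm f"
    using coord_bounded[OF assms] by blast
  have "norm (coord smul x n f) \<le> K / norm (x n) * norm f" for f
    using K(2)[of n f] basis_vector_nonzero[OF assms, of n] by (simp add: pos_le_divide_eq)
  then show ?thesis
    unfolding bounded_functional_def using coord_add[OF assms] coord_scale[OF assms] by blast
qed

text \<open>After normalization \<open>coord_bounded\<close> bounds all coordinate functionals by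
  one constant, as the construction of \<open>z\<close> requires.\<close>

lemma normalized_basis:
  assumes "schauder_basis smul x"
  shows "schauder_basis smul (\<lambda>n. (1 / norm (x n)) *\<^sub>R x n)"
proof (rule biorthogonal_schauder_basis(1)[where \<phi> = "\<lambda>n f. norm (x n) *\<^sub>R coord smul x n f"])
  have nz: "norm (x n) \<noteq> 0" for n using basis_vector_nonzero[OF assms] by simp
  show "bounded_functional (\<lambda>f. norm (x n) *\<^sub>R coord smul x n f)" for n
  proof -
    obtain K where "K \<ge> 0" "\<And>n f. norm (coord smul x n f) * norm (x n) \<le> K * norm f"
      using coord_bounded[OF assms] by blast
    then have "\<exists>K. \<forall>f. norm (norm (x n) *\<^sub>R coord smul x n f) \<le> K * norm f"
      by (intro exI[of _ K]) (simp add: mult.commute)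
    then show ?thesis
      unfolding bounded_functional_def
      by (simp add: coord_add[OF assms] coord_scale[OF assms] scaleR_add_right)
  qed
  show "norm (x n) *\<^sub>R coord smul x n ((1 / norm (x m)) *\<^sub>R x m) = (if n = m then 1 else 0)" for n m
    using nz by (simp add: coord_scale[OF assms] coord_basis[OF assms] scaleR_conv_of_real flip: scale_of_real)
  show "(\<lambda>n. smul (norm (x n) *\<^sub>R coord smul x n f) ((1 / norm (x n)) *\<^sub>R x n)) sums f" for f
    using coord_sums[OF assms, of f] nz by (simp add: smul.scaleR_left smul.scaleR_right)
qed

end

text \<open>\<open>J\<close> is the inverse isomorphism after the projection, so
  \<open>T \<circ> J\<close> is the projection onto the copy and the subspace itself need not be
  named. \<open>T\<close> is meaningful on \<open>S\<close> only, hence the membership premises in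
  its axioms.\<close>

locale complemented_copy = banach_space_over smul
  for smul :: "'k::real_or_complex_field \<Rightarrow> 'a::banach \<Rightarrow> 'a" +
  fixes S :: "(nat \<Rightarrow> 'k) set" and N :: "(nat \<Rightarrow> 'k) \<Rightarrow> real"
    and T :: "(nat \<Rightarrow> 'k) \<Rightarrow> 'a" and J :: "'a \<Rightarrow> nat \<Rightarrow> 'k"
  assumes S_add: "a \<in> S \<Longrightarrow> b \<in> S \<Longrightarrow> (\<lambda>n. a n + b n) \<in> S"
    and S_scale: "a \<in> S \<Longrightarrow> (\<lambda>n. c * a n) \<in> S"
    and N_nonneg: "a \<in> S \<Longrightarrow> 0 \<le> N a"
    and T_add: "a \<in> S \<Longrightarrow> b \<in> S \<Longrightarrow> T (\<lambda>n. a n + b n) = T a + T b"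
    and T_scale: "a \<in> S \<Longrightarrow> T (\<lambda>n. c * a n) = smul c (T a)"
    and T_bounded: "\<exists>K\<ge>0. \<forall>a\<in>S. norm (T a) \<le> K * N a"
    and J_mem: "J f \<in> S"
    and J_add: "J (f + g) = (\<lambda>n. J f n + J g n)"
    and J_scale: "J (smul c f) = (\<lambda>n. c * J f n)"
    and J_bounded: "\<exists>K\<ge>0. \<forall>f. N (J f) \<le> K * norm f"
    and J_T: "a \<in> S \<Longrightarrow> J (T a) = a"

lemma (in banach_space_over) complemented_copy_exists:
  assumes iso: "isomorphic_to_complemented_subspace S N smul"
    and S_add: "\<And>a b. a \<in> S \<Longrightarrow> b \<in> S \<Longrightarrow> (\<lambda>n. a n + b n) \<in> S"
    and S_scale: "\<And>a c. a \<in> S \<Longrightarrow> (\<lambda>n. c * a n) \<in> S"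
    and N_nonneg: "\<And>a. a \<in> S \<Longrightarrow> 0 \<le> N a"
  obtains T J where "complemented_copy smul S N T J"
proof -
  obtain Y T P where P: "bounded_linear_operator smul P" "P \<circ> P = P" "range P = Y"
    and T: "seq_space_isomorphism smul S N Y T"
    using iso unfolding isomorphic_to_complemented_subspace_def complemented_subspace_def by blast
  have bij: "bij_betw T S Y"
    and T_add: "\<And>a b. a \<in> S \<Longrightarrow> b \<in> S \<Longrightarrow> T (\<lambda>n. a n + b n) = T a + T b"
    and T_scale: "\<And>c a. a \<in> S \<Longrightarrow> T (\<lambda>n. c * a n) = smul c (T a)"
    and T_upper: "\<exists>K. \<forall>a\<in>S. norm (T a) \<le> K * N a"
    and T_lower: "\<exists>K. \<forall>a\<in>S. N a \<le> K * norm (T a)"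
    using T unfolding seq_space_isomorphism_def by blast+
  define J where "J f = inv_into S T (P f)" for f
  have J_mem: "J f \<in> S" and T_J: "T (J f) = P f" for f
  proof -
    have "P f \<in> T ` S" using bij P(3) by (auto simp: bij_betw_def)
    then show "J f \<in> S" "T (J f) = P f"
      unfolding J_def by (simp_all add: inv_into_into f_inv_into_f)
  qed
  have inj: "a = b" if "T a = T b" "a \<in> S" "b \<in> S" for a b
    using bij that by (auto simp: bij_betw_def dest: inj_onD)
  show thesis
  proof (rule that[of T J], unfold_locales)
    show "J (T a) = a" if "a \<in> S" for a
    proof (rule inj[OF _ J_mem that])
      have "T a \<in> range P" using bij P(3) that by (auto simp: bij_betw_def)
      then have "P (T a) = T a" using P(2) by (metis comp_apply rangeE)
      then show "T (J (T a)) = T a" by (simp add: T_J)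
    qed
    show "J (f + g) = (\<lambda>n. J f n + J g n)" for f g
      by (rule inj) (simp_all add: J_mem S_add T_J T_add bounded_linear_operator_add[OF P(1)])
    show "J (smul c f) = (\<lambda>n. c * J f n)" for c f
      by (rule inj) (simp_all add: J_mem S_scale T_J T_scale bounded_linear_operator_scale[OF P(1)])
    show "\<exists>K\<ge>0. \<forall>a\<in>S. norm (T a) \<le> K * N a"
    proof -
      obtain K where K: "\<And>a. a \<in> S \<Longrightarrow> norm (T a) \<le> K * N a" using T_upper by blast
      have "norm (T a) \<le> \<bar>K\<bar> * N a" if "a \<in> S" for a
        by (rule order_trans[OF K[OF that] mult_right_mono[OF abs_ge_self N_nonneg[OF that]]])
      then show ?thesis by (intro exI[of _ "\<bar>K\<bar>"]) auto
    qed
    show "\<exists>K\<ge>0. \<forall>f. N (J f) \<le> K * norm f"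
    proof -
      obtain K where K: "\<And>a. a \<in> S \<Longrightarrow> N a \<le> K * norm (T a)" using T_lower by blast
      obtain L where L: "\<And>f. norm (P f) \<le> norm f * L" "L \<ge> 0"
        using bounded_linear.nonneg_bounded[OF bounded_linear_operator_imp[OF P(1)]] by blast
      have "N (J f) \<le> \<bar>K\<bar> * L * norm f" for f
      proof -
        have "N (J f) \<le> K * norm (P f)" using K[OF J_mem] by (simp add: T_J)
        also have "\<dots> \<le> \<bar>K\<bar> * (norm f * L)" by (intro mult_mono L) auto
        finally show ?thesis by (simp add: mult_ac)
      qed
      then show ?thesis using L(2) by (intro exI[of _ "\<bar>K\<bar> * L"]) auto
    qed
  qed (fact S_add S_scale N_nonneg T_add T_scale J_mem)+
qed

context complemented_copy
begin

lemma S_zero: "(\<lambda>n. 0) \<in> S"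
  using S_scale[OF J_mem, of 0] by simp

lemma S_diff: "a \<in> S \<Longrightarrow> b \<in> S \<Longrightarrow> (\<lambda>n. a n - b n) \<in> S"
  using S_add[OF _ S_scale[of b "- 1"], of a] by simp

lemma S_sum: "(\<And>i. i \<in> A \<Longrightarrow> a i \<in> S) \<Longrightarrow> (\<lambda>n. \<Sum>i\<in>A. a i n) \<in> S"
  by (induction A rule: infinite_finite_induct) (auto simp: S_zero intro: S_add)

lemma T_zero: "T (\<lambda>n. 0) = 0"
  using T_scale[OF S_zero, of 0] by simp

lemma T_diff: "a \<in> S \<Longrightarrow> b \<in> S \<Longrightarrow> T (\<lambda>n. a n - b n) = T a - T b"
  using T_add[OF _ S_scale[of b "- 1"], of a] T_scale[of b "- 1"] by simp

lemma T_sum: "(\<And>i. i \<in> A \<Longrightarrow> a i \<in> S) \<Longrightarrow> T (\<lambda>n. \<Sum>i\<in>A. a i n) = (\<Sum>i\<in>A. T (a i))"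
  by (induction A rule: infinite_finite_induct) (auto simp: T_zero T_add S_sum)

lemma T_linear_combination:
  assumes "\<And>i. i \<in> A \<Longrightarrow> a i \<in> S"
  shows "T (\<lambda>n. \<Sum>i\<in>A. c i * a i n) = (\<Sum>i\<in>A. smul (c i) (T (a i)))"
  using T_sum[of A "\<lambda>i n. c i * a i n"] assms by (simp add: S_scale T_scale)

lemma J_diff: "J (f - g) = (\<lambda>n. J f n - J g n)"
  using J_add[of f "smul (- 1) g"] by (simp only: J_scale) simp

end

text \<open>If \<open>S\<close> is isomorphic to \<open>S \<oplus> W\<close> through the left inverse \<open>u'\<close> of \<open>u\<close>, then the whole space
  is isomorphic to its direct sum with \<open>W\<close>: it is the range of \<open>emb\<close> plus the copy of the kernel
  of \<open>u'\<close>.\<close>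

locale absorbed_summand = complemented_copy smul S N T J
  for smul :: "'k::real_or_complex_field \<Rightarrow> 'a::banach \<Rightarrow> 'a" and S N T J +
  fixes u u' :: "(nat \<Rightarrow> 'k) \<Rightarrow> nat \<Rightarrow> 'k"
  assumes u_mem: "a \<in> S \<Longrightarrow> u a \<in> S"
    and u'_mem: "a \<in> S \<Longrightarrow> u' a \<in> S"
    and u_add: "u (\<lambda>n. a n + b n) = (\<lambda>n. u a n + u b n)"
    and u'_add: "u' (\<lambda>n. a n + b n) = (\<lambda>n. u' a n + u' b n)"
    and u_scale: "u (\<lambda>n. c * a n) = (\<lambda>n. c * u a n)"
    and u'_scale: "u' (\<lambda>n. c * a n) = (\<lambda>n. c * u' a n)"
    and u_bounded: "\<exists>K\<ge>0. \<forall>a\<in>S. N (u a) \<le> K * N a"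
    and u'_bounded: "\<exists>K\<ge>0. \<forall>a\<in>S. N (u' a) \<le> K * N a"
    and u'_u: "u' (u a) = a"
begin

text \<open>On the copy of \<open>S\<close> these two operators act as \<open>u\<close> and
  \<open>u'\<close>; on the kernel of \<open>J\<close> both are the identity. \<open>res\<close> is
  the projection of \<open>S\<close> onto the kernel of \<open>u'\<close> along the range of
  \<open>u\<close>.\<close>

definition emb :: "'a \<Rightarrow> 'a" where "emb f = f - T (J f) + T (u (J f))"
definition ext :: "'a \<Rightarrow> 'a" where "ext f = f - T (J f) + T (u' (J f))"
definition res :: "(nat \<Rightarrow> 'k) \<Rightarrow> nat \<Rightarrow> 'k" where "res a = (\<lambda>n. a n - u (u' a) n)"

lemma u'_diff: "u' (\<lambda>n. a n - b n) = (\<lambda>n. u' a n - u' b n)"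
  using u'_add[of a "\<lambda>n. (- 1) * b n"] u'_scale[of "- 1" b] by simp

lemma res_mem: "a \<in> S \<Longrightarrow> res a \<in> S"
  unfolding res_def by (intro S_diff u_mem u'_mem)

lemma u'_res: "u' (res a) = (\<lambda>n. 0)"
  unfolding res_def by (simp add: u'_diff u'_u)

lemma res_u: "res (u a) = (\<lambda>n. 0)"
  by (simp add: res_def u'_u)

lemma bounded_linear_operator_perturb:
  assumes mem: "\<And>a. a \<in> S \<Longrightarrow> v a \<in> S"
    and add: "\<And>a b. v (\<lambda>n. a n + b n) = (\<lambda>n. v a n + v b n)"
    and scale: "\<And>c a. v (\<lambda>n. c * a n) = (\<lambda>n. c * v a n)"
    and bdd: "\<exists>K\<ge>0. \<forall>a\<in>S. N (v a) \<le> K * N a"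
  shows "bounded_linear_operator smul (\<lambda>f. f - T (J f) + T (v (J f)))"
proof -
  obtain KT where KT: "KT \<ge> 0" "\<And>a. a \<in> S \<Longrightarrow> norm (T a) \<le> KT * N a" using T_bounded by blast
  obtain KJ where KJ: "KJ \<ge> 0" "\<And>f. N (J f) \<le> KJ * norm f" using J_bounded by blast
  obtain Kv where Kv: "Kv \<ge> 0" "\<And>a. a \<in> S \<Longrightarrow> N (v a) \<le> Kv * N a" using bdd by blast
  show ?thesis
  proof (rule bounded_linear_operatorI)
    show "f + g - T (J (f + g)) + T (v (J (f + g))) =
        (f - T (J f) + T (v (J f))) + (g - T (J g) + T (v (J g)))" for f g
      by (simp add: J_add T_add J_mem add mem)
    show "smul c f - T (J (smul c f)) + T (v (J (smul c f))) = smul c (f - T (J f) + T (v (J f)))" for c f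
      by (simp add: J_scale T_scale J_mem scale mem scale_right_diff_distrib scale_right_distrib)
    show "norm (f - T (J f) + T (v (J f))) \<le> (1 + KT * KJ + KT * (Kv * KJ)) * norm f" for f
    proof -
      have "norm (T (J f)) \<le> KT * (KJ * norm f)"
        by (rule order_trans[OF KT(2)[OF J_mem] mult_left_mono[OF KJ(2) KT(1)]])
      moreover have "norm (T (v (J f))) \<le> KT * (Kv * (KJ * norm f))"
        by (rule order_trans[OF KT(2)[OF mem[OF J_mem]] mult_left_mono[OF
              order_trans[OF Kv(2)[OF J_mem] mult_left_mono[OF KJ(2) Kv(1)]] KT(1)]])
      moreover have "norm (f - T (J f) + T (v (J f))) \<le> norm f + norm (T (J f)) + norm (T (v (J f)))"
        using norm_triangle_ineq[of "f - T (J f)" "T (v (J f))"] norm_triangle_ineq4[of f "T (J f)"]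
        by linarith
      ultimately show ?thesis by (simp add: algebra_simps)
    qed
  qed
qed

lemma emb_operator: "bounded_linear_operator smul emb"
  unfolding emb_def[abs_def] by (rule bounded_linear_operator_perturb[OF u_mem u_add u_scale u_bounded])

lemma ext_operator: "bounded_linear_operator smul ext"
  unfolding ext_def[abs_def] by (rule bounded_linear_operator_perturb[OF u'_mem u'_add u'_scale u'_bounded])

lemma J_emb: "J (emb f) = u (J f)"
  by (simp add: emb_def J_add J_diff J_T J_mem u_mem)

lemma J_ext: "J (ext f) = u' (J f)"
  by (simp add: ext_def J_add J_diff J_T J_mem u'_mem)

lemma ext_emb: "ext (emb f) = f"
  unfolding ext_def J_emb by (simp add: emb_def u'_u)

text \<open>This is the splitting of the space into the range of \<open>emb\<close> and the copy of
  the kernel of \<open>u'\<close>. Both bases constructed from it expand the two summands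
  separately.\<close>

lemma emb_ext: "emb (ext f) = f - T (res (J f))"
  unfolding emb_def J_ext by (simp add: ext_def res_def T_diff J_mem u_mem u'_mem)

lemma ext_T: "a \<in> S \<Longrightarrow> ext (T a) = T (u' a)"
  by (simp add: ext_def J_T)

lemmas emb_linear = bounded_linear_operator_imp[OF emb_operator]
lemmas ext_linear = bounded_linear_operator_imp[OF ext_operator]
lemmas emb_scale = bounded_linear_operator_scale[OF emb_operator]
lemmas ext_scale = bounded_linear_operator_scale[OF ext_operator]

end

subsection \<open>A conditional basis from a complemented copy of \<open>c_null\<close>\<close>
lemma sum_lessThan_double:
  fixes g :: "nat \<Rightarrow> 'b::comm_monoid_add"
  shows "(\<Sum>n<2 * K. g n) = (\<Sum>k<K. g (2 * k) + g (Suc (2 * k)))"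
  by (induction K) (simp_all add: ac_simps)

lemma sums_interleave:
  fixes f g :: "nat \<Rightarrow> 'b::real_normed_vector"
  assumes "f sums x" "g sums y"
  shows "(\<lambda>n. if even n then f (n div 2) else g (n div 2)) sums (x + y)"
proof -
  define F where "F n = (if even n then f (n div 2) else 0)" for n
  define G where "G n = (if odd n then g (n div 2) else 0)" for n
  have "(\<lambda>n. F (2 * n)) sums x \<longleftrightarrow> F sums x"
    by (rule sums_mono_reindex) (auto simp: strict_mono_def F_def)
  then have "F sums x" using assms(1) by (simp add: F_def)
  have "(\<lambda>n. G (2 * n + 1)) sums y \<longleftrightarrow> G sums y"
    by (rule sums_mono_reindex) (auto simp: strict_mono_def G_def elim!: oddE)
  then have "G sums y" using assms(2) by (simp add: G_def)
  have "(\<lambda>n. if even n then f (n div 2) else g (n div 2)) = (\<lambda>n. F n + G n)"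
    by (auto simp: F_def G_def)
  then show ?thesis using sums_add[OF \<open>F sums x\<close> \<open>G sums y\<close>] by simp
qed

section \<open>The space \<open>c_null\<close>, its even and odd places, and its summing
  basis\<close>

lemma c_null_norm_ge:
  assumes "a \<in> c_null"
  shows "norm (a n) \<le> c_null_norm a"
proof -
  have "a \<longlonglongrightarrow> 0" using assms by (simp add: c_null_def)
  then have "Bseq a" by (metis convergent_def convergent_imp_Bseq)
  then have "bdd_above (range (\<lambda>n. norm (a n)))"
    unfolding Bseq_def by (auto simp: bdd_above_def)
  then show ?thesis
    unfolding c_null_norm_def by (intro cSUP_upper) auto
qed

lemma c_null_norm_le:
  assumes "\<And>n. norm (a n) \<le> R"
  shows "c_null_norm a \<le> R"
  unfolding c_null_norm_def using assms by (intro cSUP_least) auto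

lemma c_null_norm_nonneg: "a \<in> c_null \<Longrightarrow> 0 \<le> c_null_norm a"
  using c_null_norm_ge[of a 0] norm_ge_zero order_trans by blast

lemma c_null_add: "a \<in> c_null \<Longrightarrow> b \<in> c_null \<Longrightarrow> (\<lambda>n. a n + b n) \<in> c_null"
  unfolding c_null_def using tendsto_add[of a 0 sequentially b 0] by simp

lemma c_null_scale: "a \<in> c_null \<Longrightarrow> (\<lambda>n. c * a n) \<in> c_null"
  unfolding c_null_def using tendsto_mult_right_zero by auto

text \<open>The kernel of \<open>evens\<close>, its left inverse, consists of the sequences living
  on the odd places. This is the second copy of \<open>c_null\<close> that is absorbed.\<close>

definition spread :: "(nat \<Rightarrow> 'k::real_or_complex_field) \<Rightarrow> nat \<Rightarrow> 'k" where
  "spread a n = (if even n then a (n div 2) else 0)"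

definition evens :: "(nat \<Rightarrow> 'k::real_or_complex_field) \<Rightarrow> nat \<Rightarrow> 'k" where
  "evens a n = a (2 * n)"

lemma spread_c_null:
  assumes "a \<in> c_null"
  shows "spread a \<in> c_null"
proof -
  have "filterlim (\<lambda>n::nat. n div 2) at_top sequentially"
    unfolding filterlim_at_top eventually_sequentially
    by (metis div_le_mono nonzero_mult_div_cancel_left zero_neq_numeral)
  then have "(\<lambda>n. a (n div 2)) \<longlonglongrightarrow> 0"
    using assms unfolding c_null_def by (auto intro: filterlim_compose)
  then have "spread a \<longlonglongrightarrow> 0"
    by (intro Lim_null_comparison[of "spread a" "\<lambda>n. norm (a (n div 2))"] tendsto_norm_zero)
      (simp add: spread_def)
  then show ?thesis by (simp add: c_null_def)
qed

lemma evens_c_null: "a \<in> c_null \<Longrightarrow> evens a \<in> c_null"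
  unfolding c_null_def evens_def
  using LIMSEQ_subseq_LIMSEQ[of a 0 "\<lambda>n. 2 * n"] by (auto simp: strict_mono_def o_def)

lemma absorbed_summand_c_null:
  assumes "complemented_copy smul c_null c_null_norm T J"
  shows "absorbed_summand smul c_null c_null_norm T J spread evens"
proof -
  interpret complemented_copy smul c_null c_null_norm T J by fact
  show ?thesis
  proof
    show "\<exists>K\<ge>0. \<forall>a\<in>c_null. c_null_norm (spread a :: nat \<Rightarrow> 'a) \<le> K * c_null_norm a"
      by (intro exI[of _ 1]) (auto simp: spread_def c_null_norm_nonneg intro!: c_null_norm_le c_null_norm_ge)
    show "\<exists>K\<ge>0. \<forall>a\<in>c_null. c_null_norm (evens a :: nat \<Rightarrow> 'a) \<le> K * c_null_norm a"
      by (intro exI[of _ 1]) (auto simp: evens_def intro!: c_null_norm_le c_null_norm_ge)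
  qed (auto simp: spread_c_null evens_c_null spread_def evens_def fun_eq_iff)
qed

text \<open>The summing basis of \<open>c_null\<close>, moved to the odd places. Alternating sums of its members
  stay bounded, while the sums of every second member grow linearly.\<close>

definition odd_summing :: "nat \<Rightarrow> nat \<Rightarrow> 'k::real_or_complex_field" where
  "odd_summing k i = (if odd i \<and> i \<le> 2 * k + 1 then 1 else 0)"

lemma odd_summing_c_null: "odd_summing k \<in> c_null"
proof -
  have "eventually (\<lambda>i. odd_summing k i = (0::'a)) sequentially"
    using eventually_gt_at_top[of "2 * k + 1"] by eventually_elim (simp add: odd_summing_def)
  then show ?thesis unfolding c_null_def by (simp add: tendsto_eventually)
qed

lemma odd_summing_odd: "odd_summing k (2 * j + 1) = (if j \<le> k then 1 else 0)"
  by (simp add: odd_summing_def)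

lemma odd_summing_even: "even i \<Longrightarrow> odd_summing k i = 0"
  by (simp add: odd_summing_def)

text \<open>The coefficients in the summing basis are successive differences. The telescoped sum is
  off by the single value \<open>x (2 * N + 1)\<close> on the first \<open>N\<close> odd places and
  cuts off the others, so for a null sequence the error tends to zero uniformly.\<close>

lemma odd_summing_telescope:
  "(\<Sum>k<N. (x (2 * k + 1) - x (2 * k + 3)) * odd_summing k (2 * j + 1))
    = (if j < N then x (2 * j + 1) - x (2 * N + 1) else 0)"
proof (induction N)
  case (Suc N)
  then show ?case
    unfolding sum.lessThan_Suc odd_summing_odd by (auto simp: less_Suc_eq numeral_3_eq_3)
qed simp

text \<open>At place \<open>j\<close> only the terms with \<open>j \<le> k < K\<close> contribute,
  and they cancel in pairs. The entries are therefore at most 1 in modulus for every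
  \<open>K\<close>.\<close>

lemma odd_summing_alternating:
  "(\<Sum>k<K. (- 1) ^ k * odd_summing k (2 * j + 1)) = (if j < K \<and> odd (K - j) then (- 1) ^ j else 0)"
proof (induction K)
  case (Suc K)
  show ?case
  proof (cases "j \<le> K")
    case True
    then obtain d where d: "K = j + d" using le_Suc_ex by blast
    have "odd_summing (j + d) (Suc (2 * j)) = (1::'a)" by (simp add: odd_summing_def)
    then show ?thesis using Suc by (cases "even d") (auto simp: d power_add odd_pos)
  qed (use Suc in \<open>auto simp: odd_summing_def\<close>)
qed simp

text \<open>The given basis, moved by \<open>emb\<close>, takes the even indices, and the summing
  basis of the absorbed copy takes the odd ones. Growth is stated through explicit coefficients and
  index sets instead of a supremum, because exactly these witnesses are transported to the new basis
  in \<open>linear_le_w_cond\<close>.\<close>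

lemma (in banach_space_over) conditional_basis_exists:
  assumes c_null: "isomorphic_to_complemented_subspace c_null c_null_norm smul"
    and basis: "\<exists>y. schauder_basis smul y"
  shows "\<exists>z B M d. schauder_basis smul z \<and> B > 0 \<and> (\<forall>n. norm (z n) \<le> B) \<and>
    (\<forall>n f. norm (coord smul z n f) \<le> B * norm f) \<and> d > 0 \<and>
    (\<forall>K. \<exists>\<beta> A. norm (\<Sum>n<2 * K. smul (\<beta> n) (z n)) \<le> M \<and>
       d * real K \<le> norm (\<Sum>n<2 * K. if n \<in> A then smul (\<beta> n) (z n) else 0))"
proof -
  obtain T J where "complemented_copy smul c_null c_null_norm T J"
    using complemented_copy_exists[OF c_null c_null_add c_null_scale c_null_norm_nonneg] by blast
  then interpret absorbed_summand smul c_null c_null_norm T J spread evens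
    by (rule absorbed_summand_c_null)
  obtain y where y: "schauder_basis smul y" and ny: "\<And>n. norm (y n) = 1"
  proof -
    obtain y0 where y0: "schauder_basis smul y0" using basis by blast
    show thesis
      by (rule that[OF normalized_basis[OF y0]]) (simp add: basis_vector_nonzero[OF y0])
  qed
  obtain Ky where Ky: "Ky \<ge> 0" "\<And>n f. norm (coord smul y n f) \<le> Ky * norm f"
    using coord_bounded[OF y] ny by auto
  obtain Ke where Ke: "\<And>f. norm (emb f) \<le> norm f * Ke" "Ke \<ge> 0"
    using bounded_linear.nonneg_bounded[OF emb_linear] by blast
  obtain Kx where Kx: "\<And>f. norm (ext f) \<le> norm f * Kx" "Kx \<ge> 0"
    using bounded_linear.nonneg_bounded[OF ext_linear] by blast
  obtain KT where KT: "KT \<ge> 0" "\<And>a. a \<in> c_null \<Longrightarrow> norm (T a) \<le> KT * c_null_norm a"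
    using T_bounded by blast
  obtain KJ where KJ: "KJ \<ge> 0" "\<And>f. c_null_norm (J f) \<le> KJ * norm f" using J_bounded by blast
  have T_le: "norm (T a) \<le> KT * R" if "a \<in> c_null" "\<And>i. norm (a i) \<le> R" for a R
    using order_trans[OF KT(2)[OF that(1)] mult_left_mono[OF c_null_norm_le[OF that(2)] KT(1)]] by blast
  have J_le: "norm (J f i) \<le> KJ * norm f" for f i
    using order_trans[OF c_null_norm_ge[OF J_mem] KJ(2)] .
  define z where "z n = (if even n then emb (y (n div 2)) else T (odd_summing (n div 2)))" for n
  \<comment> \<open>For odd \<open>n = 2 * k + 1\<close> the index agrees with the place, so the
    dual of \<open>odd_summing k\<close> is a difference of two neighbouring odd places of
    \<open>J f\<close>. Vectors of the range of \<open>emb\<close> vanish there by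
    \<open>J_emb\<close>.\<close>
  define \<phi> where "\<phi> n f = (if even n then coord smul y (n div 2) (ext f) else J f n - J f (n + 2))" for n f
  define B where "B = Ke + KT + Ky * Kx + 2 * KJ + 1"
  have B: "Ke \<le> B" "KT \<le> B" "Ky * Kx \<le> B" "2 * KJ \<le> B" "B > 0"
    using Ke(2) KT(1) KJ(1) mult_nonneg_nonneg[OF Ky(1) Kx(2)] unfolding B_def by linarith+
  have \<phi>_bound: "norm (\<phi> n f) \<le> B * norm f" for n f
  proof (cases "even n")
    case True
    have "norm (\<phi> n f) \<le> Ky * norm (ext f)" using True Ky(2) by (simp add: \<phi>_def)
    also have "\<dots> \<le> Ky * Kx * norm f"
      using mult_left_mono[OF Kx(1)[of f] Ky(1)] by (simp add: mult_ac)
    also have "\<dots> \<le> B * norm f" by (intro mult_right_mono B) simp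
    finally show ?thesis .
  next
    case False
    have "norm (\<phi> n f) \<le> norm (J f n) + norm (J f (n + 2))"
      using False by (simp add: \<phi>_def norm_triangle_ineq4)
    also have "\<dots> \<le> 2 * KJ * norm f" using J_le[of f n] J_le[of f "n + 2"] by simp
    also have "\<dots> \<le> B * norm f" by (intro mult_right_mono B) simp
    finally show ?thesis .
  qed
  have \<phi>: "bounded_functional (\<phi> n)" for n
    unfolding bounded_functional_def
  proof (intro conjI allI)
    show "\<phi> n (f + g) = \<phi> n f + \<phi> n g" for f g
      by (simp add: \<phi>_def J_add coord_add[OF y] bounded_linear_operator_add[OF ext_operator])
    show "\<phi> n (smul c f) = c * \<phi> n f" for c f
      by (simp add: \<phi>_def J_scale coord_scale[OF y] ext_scale algebra_simps)
    show "\<exists>K. \<forall>f. norm (\<phi> n f) \<le> K * norm f" using \<phi>_bound by blast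
  qed
  have ext_w: "ext (T (odd_summing k)) = 0" for k
  proof -
    have "evens (odd_summing k :: nat \<Rightarrow> 'k) = (\<lambda>n. 0)" by (auto simp: evens_def odd_summing_def)
    then show ?thesis by (simp add: ext_T[OF odd_summing_c_null] T_zero)
  qed
  have biorth: "\<phi> n (z m) = (if n = m then 1 else 0)" for n m
  proof (cases "even n"; cases "even m")
    assume "even n" "even m"
    then show ?thesis
      by (auto simp: \<phi>_def z_def ext_emb coord_basis[OF y] elim!: evenE)
  next
    assume "even n" "odd m"
    then show ?thesis by (auto simp: \<phi>_def z_def ext_w coord_zero[OF y])
  next
    assume "odd n" "even m"
    then show ?thesis by (auto simp: \<phi>_def z_def J_emb spread_def)
  next
    assume "odd n" "odd m"
    then show ?thesis
      by (auto simp: \<phi>_def z_def J_T[OF odd_summing_c_null] odd_summing_def elim!: oddE)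
  qed
  have sums_even: "(\<lambda>k. smul (coord smul y k (ext f)) (emb (y k))) sums emb (ext f)" for f
    using bounded_linear.sums[OF emb_linear coord_sums[OF y, of "ext f"]] by (simp add: emb_scale)
  have sums_odd: "(\<lambda>k. smul (J f (2 * k + 1) - J f (2 * k + 3)) (T (odd_summing k))) sums T (res (J f))" for f
    unfolding sums_def
  proof (rule metric_LIMSEQ_I)
    fix e :: real assume e: "e > 0"
    have "J f \<longlonglongrightarrow> 0" using J_mem[of f] by (simp add: c_null_def)
    \<comment> \<open>Adding 1 to \<open>KT\<close> keeps the quotient meaningful for
      \<open>KT = 0\<close> and makes the final estimate strict.\<close>
    then obtain M where M: "\<And>n. n \<ge> M \<Longrightarrow> norm (J f n) < e / (KT + 1)"
      using metric_LIMSEQ_D[of "J f" 0 "e / (KT + 1)"] e KT(1) by (auto simp: add_nonneg_pos)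
    have "norm ((\<Sum>k<N. smul (J f (2 * k + 1) - J f (2 * k + 3)) (T (odd_summing k))) - T (res (J f))) < e"
      if "N \<ge> M" for N
    proof -
      define a where "a i = (\<Sum>k<N. (J f (2 * k + 1) - J f (2 * k + 3)) * odd_summing k i)" for i
      have a: "a \<in> c_null"
        unfolding a_def by (intro S_sum S_scale odd_summing_c_null)
      have le: "norm (a i - res (J f) i) \<le> e / (KT + 1)" for i
      proof (cases "even i")
        case True
        then show ?thesis using e KT(1)
          by (simp add: a_def odd_summing_even res_def spread_def evens_def)
      next
        case False
        then obtain j where i: "i = 2 * j + 1" by (rule oddE)
        have "a i - res (J f) i = (if j < N then - J f (2 * N + 1) else - J f i)"
          unfolding a_def i odd_summing_telescope by (simp add: res_def spread_def)
        then show ?thesis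
          using M[of "2 * N + 1"] M[of i] \<open>N \<ge> M\<close> by (auto simp: i)
      qed
      have "(\<Sum>k<N. smul (J f (2 * k + 1) - J f (2 * k + 3)) (T (odd_summing k))) = T a"
        unfolding a_def by (rule T_linear_combination[symmetric]) (rule odd_summing_c_null)
      then have "norm ((\<Sum>k<N. smul (J f (2 * k + 1) - J f (2 * k + 3)) (T (odd_summing k))) - T (res (J f)))
          = norm (T (\<lambda>i. a i - res (J f) i))"
        by (simp add: T_diff a res_mem J_mem)
      also have "\<dots> \<le> KT * (e / (KT + 1))"
        by (intro T_le le S_diff a res_mem J_mem)
      also have "\<dots> < e" using e KT(1) by (simp add: field_simps)
      finally show ?thesis .
    qed
    then show "\<exists>M. \<forall>N\<ge>M. dist (\<Sum>k<N. smul (J f (2 * k + 1) - J f (2 * k + 3)) (T (odd_summing k)))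
        (T (res (J f))) < e"
      by (auto simp: dist_norm)
  qed
  have sums: "(\<lambda>n. smul (\<phi> n f) (z n)) sums f" for f
  proof -
    have "(\<lambda>n. smul (\<phi> n f) (z n)) = (\<lambda>n. if even n
        then smul (coord smul y (n div 2) (ext f)) (emb (y (n div 2)))
        else smul (J f (2 * (n div 2) + 1) - J f (2 * (n div 2) + 3)) (T (odd_summing (n div 2))))"
    proof
      fix n :: nat
      have "2 * (n div 2) + 1 = n" "2 * (n div 2) + 3 = n + 2" if "odd n"
        using that by presburger+
      then show "smul (\<phi> n f) (z n) = (if even n
        then smul (coord smul y (n div 2) (ext f)) (emb (y (n div 2)))
        else smul (J f (2 * (n div 2) + 1) - J f (2 * (n div 2) + 3)) (T (odd_summing (n div 2))))"
        by (cases "even n") (simp_all only: \<phi>_def z_def if_True if_False not_False_eq_True)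
    qed
    moreover have "emb (ext f) + T (res (J f)) = f" by (simp add: emb_ext)
    ultimately show ?thesis using sums_interleave[OF sums_even[of f] sums_odd[of f]] by simp
  qed
  note basis_z = biorthogonal_schauder_basis[OF \<phi> biorth sums]
  have z_bound: "norm (z n) \<le> B" for n
  proof (cases "even n")
    case True
    then have "norm (z n) \<le> Ke" using Ke(1)[of "y (n div 2)"] by (simp add: z_def ny)
    then show ?thesis using B by simp
  next
    case False
    have "norm (T (odd_summing (n div 2))) \<le> KT * 1"
      by (rule T_le[OF odd_summing_c_null]) (simp add: odd_summing_def)
    then show ?thesis using False B by (simp add: z_def)
  qed
  have growth: "\<exists>\<beta> A. norm (\<Sum>n<2 * K. smul (\<beta> n) (z n)) \<le> KT \<and>
       1 / (2 * (KJ + 1)) * real K \<le> norm (\<Sum>n<2 * K. if n \<in> A then smul (\<beta> n) (z n) else 0)" for K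
  proof -
    \<comment> \<open>Alternating signs on the odd indices keep the full sum bounded;
      \<open>A\<close> retains the positive signs only, which destroys the cancellation.\<close>
    define \<beta> :: "nat \<Rightarrow> 'k" where "\<beta> n = (if even n then 0 else (- 1) ^ (n div 2))" for n
    define A :: "nat set" where "A = {n. odd n \<and> even (n div 2)}"
    define a b :: "nat \<Rightarrow> 'k"
      where "a i = (\<Sum>k<K. (- 1) ^ k * odd_summing k i)"
        and "b i = (\<Sum>k<K. (if even k then 1 else 0) * odd_summing k i)" for i
    have b: "b \<in> c_null" unfolding b_def by (intro S_sum S_scale odd_summing_c_null)
    have "(\<Sum>n<2 * K. smul (\<beta> n) (z n)) = (\<Sum>k<K. smul ((- 1) ^ k) (T (odd_summing k)))"
      unfolding sum_lessThan_double by (simp add: \<beta>_def z_def)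
    also have "\<dots> = T a"
      unfolding a_def by (rule T_linear_combination[symmetric]) (rule odd_summing_c_null)
    also have "norm (T a) \<le> KT * 1"
    proof (rule T_le)
      show "a \<in> c_null" unfolding a_def by (intro S_sum S_scale odd_summing_c_null)
      show "norm (a i) \<le> 1" for i
      proof (cases "even i")
        case False
        then obtain j where i: "i = 2 * j + 1" by (rule oddE)
        show ?thesis unfolding a_def i odd_summing_alternating by (simp add: norm_power)
      qed (simp add: a_def odd_summing_even)
    qed
    finally have 1: "norm (\<Sum>n<2 * K. smul (\<beta> n) (z n)) \<le> KT" by simp
    have "(\<Sum>n<2 * K. if n \<in> A then smul (\<beta> n) (z n) else 0)
        = (\<Sum>k<K. smul (if even k then 1 else 0) (T (odd_summing k)))"
      unfolding sum_lessThan_double by (rule sum.cong) (auto simp: A_def \<beta>_def z_def)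
    also have "\<dots> = T b"
      unfolding b_def by (rule T_linear_combination[symmetric]) (rule odd_summing_c_null)
    finally have 2: "(\<Sum>n<2 * K. if n \<in> A then smul (\<beta> n) (z n) else 0) = T b" .
    \<comment> \<open>Place 1 lies in the support of every \<open>odd_summing k\<close>, so this
      entry counts the even \<open>k\<close> below \<open>K\<close>. Hence the 2 in the growth
      constant.\<close>
    have "b 1 = of_nat ((K + 1) div 2)"
      unfolding b_def by (induction K) (auto simp: odd_summing_def)
    then have "real K / 2 \<le> norm (b 1)" by (simp add: real_of_nat_div)
    also have "\<dots> \<le> KJ * norm (T b)" using J_le[of "T b" 1] by (simp add: J_T[OF b])
    also have "\<dots> \<le> (KJ + 1) * norm (T b)" by (intro mult_right_mono) auto
    finally have "1 / (2 * (KJ + 1)) * real K \<le> norm (T b)"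
      using KJ(1) by (simp add: field_simps)
    then show ?thesis using 1 2 by (intro exI[of _ \<beta>] exI[of _ A]) simp
  qed
  have coord_z: "norm (coord smul z n f) \<le> B * norm f" for n f
    unfolding basis_z(2) by (rule \<phi>_bound)
  have "1 / (2 * (KJ + 1)) > 0" using KJ(1) by simp
  with basis_z(1) B(5) z_bound coord_z growth show ?thesis by blast
qed

subsection \<open>Dyadic averaging in \<open>ell p\<close>\<close>
text \<open>The offset makes \<open>2 ^ N - 1\<close> the total length of the first \<open>N\<close>
  blocks, with block 0 equal to {0}.\<close>

definition block :: "nat \<Rightarrow> nat set" where
  "block n = {2 ^ n - 1..<2 ^ Suc n - 1}"

definition level :: "nat \<Rightarrow> nat" where
  "level j = (LEAST n. j < 2 ^ Suc n - 1)"

lemma level_less_iff: "level j < n \<longleftrightarrow> j < 2 ^ n - 1"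
proof -
  have mono: "2 ^ m - 1 \<le> (2 ^ n - 1 :: nat)" if "m \<le> n" for m n
    by (intro diff_le_mono power_increasing that) simp
  have "j < 2 ^ Suc j - 1" using less_exp[of "Suc j"] by linarith
  then have upper: "j < 2 ^ Suc (level j) - 1"
    unfolding level_def by (rule LeastI)
  show ?thesis
  proof
    assume "level j < n"
    then show "j < 2 ^ n - 1" using upper mono[of "Suc (level j)" n] by (meson Suc_leI less_le_trans)
  next
    assume j: "j < 2 ^ n - 1"
    show "level j < n"
    proof (cases n)
      case (Suc k)
      then have "level j \<le> k" unfolding level_def using j by (intro Least_le) simp
      then show ?thesis using Suc by simp
    qed (use j in simp)
  qed
qed

lemma mem_block_iff: "j \<in> block n \<longleftrightarrow> level j = n"
proof -
  have "level j = n \<longleftrightarrow> level j < Suc n \<and> \<not> level j < n" by auto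
  then show ?thesis unfolding level_less_iff block_def by auto
qed

lemma finite_block [simp]: "finite (block n)"
  by (simp add: block_def)

lemma card_block: "card (block n) = 2 ^ n"
  by (simp add: block_def)

lemma sum_lessThan_blocks:
  fixes g :: "nat \<Rightarrow> 'b::comm_monoid_add"
  shows "(\<Sum>j<2 ^ N - 1. g j) = (\<Sum>n<N. \<Sum>j\<in>block n. g j)"
proof (induction N)
  case (Suc N)
  have "{..<2 ^ Suc N - 1} = {..<2 ^ N - 1} \<union> block N"
    by (auto simp only: lessThan_iff Un_iff mem_block_iff level_less_iff[symmetric] less_Suc_eq)
  moreover have "{..<2 ^ N - 1} \<inter> block N = {}"
    by (auto simp only: disjoint_iff lessThan_iff mem_block_iff level_less_iff[symmetric])
  ultimately show ?case by (simp only: sum.lessThan_Suc Suc[symmetric]) (simp add: sum.union_disjoint)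
qed simp

text \<open>This is the \<open>ell p\<close> norm of the indicator of block
  \<open>n\<close>.\<close>

definition weight :: "real \<Rightarrow> nat \<Rightarrow> real" where
  "weight p n = 2 powr (real n / p)"

lemma weight_pos: "weight p n > 0"
  by (simp add: weight_def)

lemma weight_powr: "p > 0 \<Longrightarrow> weight p n powr p = 2 ^ n"
  by (simp add: weight_def powr_powr powr_realpow)

lemma weight_Suc: "weight p (Suc n) = 2 powr (1 / p) * weight p n"
  by (simp add: weight_def add_divide_distrib flip: powr_add)

lemma weight_mono: "p > 0 \<Longrightarrow> m \<le> n \<Longrightarrow> weight p m \<le> weight p n"
  by (simp add: weight_def divide_right_mono)

text \<open>Jensen's inequality, applied to the strictly positive terms. Replacing their number by
  \<open>card A\<close> only enlarges the bound, since \<open>p - 1\<close> is nonnegative.\<close>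

lemma powr_sum_le:
  fixes x :: "'b \<Rightarrow> real"
  assumes p: "p \<ge> 1" and A: "finite A" and x: "\<And>j. j \<in> A \<Longrightarrow> x j \<ge> 0"
  shows "(\<Sum>j\<in>A. x j) powr p \<le> real (card A) powr (p - 1) * (\<Sum>j\<in>A. x j powr p)"
proof -
  define P where "P = {j \<in> A. x j > 0}"
  have P: "finite P" "P \<subseteq> A" using A by (auto simp: P_def)
  have outside: "x j = 0" if "j \<in> A - P" for j
    using that x[of j] by (auto simp: P_def)
  have 1: "(\<Sum>j\<in>A. x j) = (\<Sum>j\<in>P. x j)"
    using outside by (intro sum.mono_neutral_right A P) auto
  have 2: "(\<Sum>j\<in>A. x j powr p) = (\<Sum>j\<in>P. x j powr p)"
    using outside by (intro sum.mono_neutral_right A P) auto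
  show ?thesis
  proof (cases "P = {}")
    case True
    then show ?thesis unfolding 1 2 using p by simp
  next
    case False
    define c where "c = real (card P)"
    have c: "c > 0" using False P(1) by (simp add: c_def card_gt_0_iff)
    have "(\<Sum>j\<in>P. (1 / c) *\<^sub>R x j) powr p \<le> (\<Sum>j\<in>P. 1 / c * x j powr p)"
      by (rule convex_on_sum[OF P(1) False powr_convex[OF p]]) (use c in \<open>auto simp: P_def c_def\<close>)
    then have le: "((\<Sum>j\<in>P. x j) / c) powr p \<le> (\<Sum>j\<in>P. x j powr p) / c"
      by (simp flip: sum_divide_distrib)
    have nonneg: "(\<Sum>j\<in>P. x j) \<ge> 0" "(\<Sum>j\<in>P. x j powr p) \<ge> 0"
      by (auto simp: P_def intro!: sum_nonneg)
    have "(\<Sum>j\<in>P. x j) powr p = c powr p * ((\<Sum>j\<in>P. x j) / c) powr p"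
      using c nonneg by (simp add: powr_divide)
    also have "\<dots> \<le> c powr p * ((\<Sum>j\<in>P. x j powr p) / c)"
      by (intro mult_left_mono le) simp
    also have "\<dots> = c powr (p - 1) * (\<Sum>j\<in>P. x j powr p)"
      using c by (simp add: powr_diff)
    also have "\<dots> \<le> real (card A) powr (p - 1) * (\<Sum>j\<in>P. x j powr p)"
      using p c nonneg card_mono[OF A P(2)] by (intro mult_right_mono powr_mono2) (auto simp: c_def)
    finally show ?thesis unfolding 1 2 .
  qed
qed

text \<open>In the power mean inequality the factor 2^(n(p-1)) is cancelled exactly by the weight,
  because \<open>weight p n powr p = 2 ^ n\<close>. So weighted block means cost no constant,
  whatever part \<open>F\<close> of the block is used.\<close>

lemma weighted_block_sum_le:
  fixes x :: "nat \<Rightarrow> real"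
  assumes p: "p > 1" and F: "F \<subseteq> block n" and x: "\<And>j. j \<in> F \<Longrightarrow> x j \<ge> 0"
  shows "(weight p n / 2 ^ n * (\<Sum>j\<in>F. x j)) powr p \<le> (\<Sum>j\<in>F. x j powr p)"
proof -
  have fin: "finite F" using F finite_block finite_subset by blast
  have "(weight p n / 2 ^ n * (\<Sum>j\<in>F. x j)) powr p
      = 2 ^ n / (2 ^ n) powr p * (\<Sum>j\<in>F. x j) powr p"
    using weight_pos[of p n] p x weight_powr[of p n]
    by (simp add: powr_mult powr_divide sum_nonneg)
  also have "\<dots> \<le> 2 ^ n / (2 ^ n) powr p * ((2 ^ n) powr (p - 1) * (\<Sum>j\<in>F. x j powr p))"
  proof (intro mult_left_mono order_trans[OF powr_sum_le])
    have "card F \<le> 2 ^ n" using card_mono[OF finite_block F] by (simp add: card_block)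
    then have "real (card F) \<le> 2 ^ n" by (metis of_nat_le_iff of_nat_numeral of_nat_power)
    then show "real (card F) powr (p - 1) * (\<Sum>j\<in>F. x j powr p) \<le> (2 ^ n) powr (p - 1) * (\<Sum>j\<in>F. x j powr p)"
      using p by (intro mult_right_mono powr_mono2 sum_nonneg) auto
  qed (use p x fin in auto)
  also have "\<dots> = (\<Sum>j\<in>F. x j powr p)"
    by (simp add: powr_diff)
  finally show ?thesis .
qed

lemma powr_add_le:
  fixes x y :: real
  assumes "p > 0" "x \<ge> 0" "y \<ge> 0"
  shows "(x + y) powr p \<le> 2 powr p * (x powr p + y powr p)"
proof -
  have "(x + y) powr p \<le> (2 * max x y) powr p"
    using assms by (intro powr_mono2) auto
  also have "\<dots> = 2 powr p * max x y powr p" using assms by (simp add: powr_mult)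
  also have "max x y powr p \<le> x powr p + y powr p" by (simp add: max_def)
  finally show ?thesis by simp
qed

section \<open>Membership and norms in \<open>ell p\<close>\<close>

lemma ell_norm_powr:
  assumes "p > 0" "a \<in> ell p"
  shows "ell_norm p a powr p = (\<Sum>n. norm (a n) powr p)"
  using assms by (simp add: ell_norm_def ell_def powr_powr suminf_nonneg)

lemma ell_norm_nonneg: "0 \<le> ell_norm p a"
  by (simp add: ell_norm_def)

lemma ell_sum_le:
  assumes "p > 0" "a \<in> ell p" "finite F"
  shows "(\<Sum>j\<in>F. norm (a j) powr p) \<le> ell_norm p a powr p"
  unfolding ell_norm_powr[OF assms(1,2)] using assms by (intro sum_le_suminf) (auto simp: ell_def)

lemma ell_memI:
  assumes "p > 0" "R \<ge> 0" "\<And>N. (\<Sum>j<N. norm (a j) powr p) \<le> R powr p"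
  shows "a \<in> ell p" and "ell_norm p a \<le> R"
proof -
  have summable: "summable (\<lambda>j. norm (a j) powr p)"
    by (rule summableI_nonneg_bounded[of _ "R powr p"]) (use assms(3) in auto)
  then show "a \<in> ell p" by (simp add: ell_def)
  have "ell_norm p a \<le> (R powr p) powr (1 / p)"
    unfolding ell_norm_def using summable assms
    by (intro powr_mono2 suminf_le_const suminf_nonneg) auto
  then show "ell_norm p a \<le> R" using assms by (simp add: powr_powr)
qed

lemma ell_add:
  assumes "p > 0" "a \<in> ell p" "b \<in> ell p"
  shows "(\<lambda>n. a n + b n) \<in> ell p"
proof -
  have s: "summable (\<lambda>n. 2 powr p * (norm (a n) powr p + norm (b n) powr p))"
    using assms by (intro summable_mult summable_add) (auto simp: ell_def)
  have le: "norm (a n + b n) powr p \<le> 2 powr p * (norm (a n) powr p + norm (b n) powr p)" for n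
    using assms(1) by (intro order_trans[OF powr_mono2[OF _ _ norm_triangle_ineq] powr_add_le]) auto
  show ?thesis
    unfolding ell_def mem_Collect_eq
  proof (rule summable_comparison_test'[OF s])
    show "norm (norm (a n + b n) powr p) \<le> 2 powr p * (norm (a n) powr p + norm (b n) powr p)" for n
      using le[of n] by (simp only: real_norm_def abs_of_nonneg powr_ge_zero)
  qed
qed

lemma ell_scale:
  assumes "a \<in> ell p"
  shows "(\<lambda>n. c * a n) \<in> ell p"
  using assms unfolding ell_def
  by (simp add: norm_mult powr_mult summable_mult)

lemma ell_finite_support:
  assumes "p > 0" "finite F" "\<And>j. j \<notin> F \<Longrightarrow> a j = 0"
  shows "a \<in> ell p" and "ell_norm p a \<le> (\<Sum>j\<in>F. norm (a j) powr p) powr (1 / p)"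
proof -
  have "(\<Sum>j<N. norm (a j) powr p) \<le> (\<Sum>j\<in>F. norm (a j) powr p)" for N
  proof -
    have "(\<Sum>j<N. norm (a j) powr p) = (\<Sum>j\<in>{..<N} \<inter> F. norm (a j) powr p)"
      using assms by (intro sum.mono_neutral_right) auto
    also have "\<dots> \<le> (\<Sum>j\<in>F. norm (a j) powr p)"
      using assms by (intro sum_mono2) auto
    finally show ?thesis .
  qed
  then have "(\<Sum>j<N. norm (a j) powr p) \<le> ((\<Sum>j\<in>F. norm (a j) powr p) powr (1 / p)) powr p" for N
    using assms(1) by (simp add: powr_powr sum_nonneg)
  from ell_memI[OF assms(1) _ this]
  show "a \<in> ell p" "ell_norm p a \<le> (\<Sum>j\<in>F. norm (a j) powr p) powr (1 / p)"
    by simp_all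
qed

lemma ell_norm_tail:
  assumes p: "p > 0" and a: "a \<in> ell p"
  shows "(\<lambda>M. ell_norm p (\<lambda>i. if i < M then 0 else a i)) \<longlonglongrightarrow> 0"
proof -
  let ?g = "\<lambda>i. norm (a i) powr p"
  have sg: "summable ?g" using a by (simp add: ell_def)
  have le: "ell_norm p (\<lambda>i. if i < M then 0 else a i) \<le> (suminf ?g - (\<Sum>i<M. ?g i)) powr (1 / p)" for M
  proof (rule ell_memI(2)[OF p])
    have rest: "suminf ?g - (\<Sum>i<M. ?g i) = (\<Sum>i. ?g (i + M))"
      using suminf_minus_initial_segment[OF sg] by simp
    have nonneg: "suminf ?g - (\<Sum>i<M. ?g i) \<ge> 0"
      unfolding rest by (intro suminf_nonneg) (auto intro: summable_ignore_initial_segment[OF sg])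
    fix N
    have "(\<Sum>j<N. norm (if j < M then 0 else a j) powr p) \<le> (\<Sum>j<N + M. norm (if j < M then 0 else a j) powr p)"
      by (intro sum_mono2) auto
    also have "\<dots> = (\<Sum>j<N + M. ?g j) - (\<Sum>j<M. ?g j)"
    proof (induction N)
      case 0
      show ?case using p by simp
    qed simp
    also have "\<dots> \<le> suminf ?g - (\<Sum>i<M. ?g i)"
      using sum_le_suminf[OF sg, of "{..<N + M}"] by simp
    finally show "(\<Sum>j<N. norm (if j < M then 0 else a j) powr p) \<le> ((suminf ?g - (\<Sum>i<M. ?g i)) powr (1 / p)) powr p"
      using p nonneg by (simp add: powr_powr)
  qed simp
  have "(\<lambda>M. (suminf ?g - (\<Sum>i<M. ?g i)) powr (1 / p)) \<longlonglongrightarrow> (suminf ?g - suminf ?g) powr (1 / p)"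
  proof (rule tendsto_powr2)
    show "(\<lambda>M. suminf ?g - (\<Sum>i<M. ?g i)) \<longlonglongrightarrow> suminf ?g - suminf ?g"
      by (intro tendsto_intros summable_LIMSEQ sg)
    show "\<forall>\<^sub>F M in sequentially. 0 \<le> suminf ?g - (\<Sum>i<M. ?g i)"
      using sum_le_suminf[OF sg] by (intro always_eventually) (simp add: p)
  qed (use p in auto)
  then have "(\<lambda>M. (suminf ?g - (\<Sum>i<M. ?g i)) powr (1 / p)) \<longlonglongrightarrow> 0" by simp
  then show ?thesis
    by (rule Lim_null_comparison[rotated]) (simp add: le ell_norm_nonneg)
qed

text \<open>The entry \<open>a n\<close> becomes the coefficient of the normalized indicator of
  block \<open>n\<close>. \<open>dyadic_mean p\<close> reads it back from a block mean, so the
  composition in \<open>dyadic_spread_mean\<close> is averaging over blocks and the associated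
  \<open>res\<close> subtracts the block mean.\<close>

definition dyadic_spread :: "real \<Rightarrow> (nat \<Rightarrow> 'k::real_or_complex_field) \<Rightarrow> nat \<Rightarrow> 'k" where
  "dyadic_spread p a j = (1 / weight p (level j)) *\<^sub>R a (level j)"

definition dyadic_mean :: "real \<Rightarrow> (nat \<Rightarrow> 'k::real_or_complex_field) \<Rightarrow> nat \<Rightarrow> 'k" where
  "dyadic_mean p a n = (weight p n / 2 ^ n) *\<^sub>R (\<Sum>j\<in>block n. a j)"

lemma dyadic_mean_spread: "dyadic_mean p (dyadic_spread p a) = a"
proof
  fix n
  have "(\<Sum>j\<in>block n. dyadic_spread p a j) = (\<Sum>j\<in>block n. (1 / weight p n) *\<^sub>R a n)"
    by (rule sum.cong) (auto simp: dyadic_spread_def mem_block_iff)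
  also have "\<dots> = (2 ^ n / weight p n) *\<^sub>R a n"
    by (simp add: card_block scaleR_conv_of_real)
  finally show "dyadic_mean p (dyadic_spread p a) n = a n"
    using weight_pos[of p n] by (simp add: dyadic_mean_def)
qed

lemma dyadic_spread_mean:
  "dyadic_spread p (dyadic_mean p a) j = (1 / 2 ^ level j) *\<^sub>R (\<Sum>i\<in>block (level j). a i)"
  using weight_pos[of p "level j"] by (simp add: dyadic_spread_def dyadic_mean_def)

lemma dyadic_spread_ell:
  assumes p: "p > 0" and a: "a \<in> ell p"
  shows "dyadic_spread p a \<in> ell p" and "ell_norm p (dyadic_spread p a) \<le> ell_norm p a"
proof -
  have le: "(\<Sum>j<N. norm (dyadic_spread p a j) powr p) \<le> ell_norm p a powr p" for N
  proof -
    have "N \<le> 2 ^ N - 1" using less_exp[of N] by linarith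
    then have "(\<Sum>j<N. norm (dyadic_spread p a j) powr p) \<le> (\<Sum>j<2 ^ N - 1. norm (dyadic_spread p a j) powr p)"
      by (intro sum_mono2) auto
    also have "\<dots> = (\<Sum>n<N. \<Sum>j\<in>block n. norm (a n) powr p / 2 ^ n)"
      unfolding sum_lessThan_blocks
    proof (intro sum.cong refl)
      fix n j assume "j \<in> block n"
      then show "norm (dyadic_spread p a j) powr p = norm (a n) powr p / 2 ^ n"
        using weight_pos[of p n] weight_powr[OF p, of n]
        by (simp add: dyadic_spread_def mem_block_iff powr_divide)
    qed
    also have "\<dots> = (\<Sum>n<N. norm (a n) powr p)"
      by (simp add: card_block)
    also have "\<dots> \<le> ell_norm p a powr p" by (rule ell_sum_le[OF p a]) simp
    finally show ?thesis .
  qed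
  show "dyadic_spread p a \<in> ell p" "ell_norm p (dyadic_spread p a) \<le> ell_norm p a"
    by (rule ell_memI[OF p ell_norm_nonneg le])+
qed

lemma dyadic_mean_ell:
  assumes p: "p > 1" and a: "a \<in> ell p"
  shows "dyadic_mean p a \<in> ell p" and "ell_norm p (dyadic_mean p a) \<le> ell_norm p a"
proof -
  have p0: "p > 0" using p by simp
  have le: "(\<Sum>n<N. norm (dyadic_mean p a n) powr p) \<le> ell_norm p a powr p" for N
  proof -
    have "norm (dyadic_mean p a n) powr p \<le> (\<Sum>j\<in>block n. norm (a j) powr p)" for n
    proof -
      have "norm (dyadic_mean p a n) \<le> weight p n / 2 ^ n * (\<Sum>j\<in>block n. norm (a j))"
        unfolding dyadic_mean_def norm_scaleR using weight_pos[of p n]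
        by (simp add: mult_left_mono norm_sum divide_right_mono)
      then have "norm (dyadic_mean p a n) powr p \<le> (weight p n / 2 ^ n * (\<Sum>j\<in>block n. norm (a j))) powr p"
        using p by (intro powr_mono2) auto
      also have "\<dots> \<le> (\<Sum>j\<in>block n. norm (a j) powr p)"
        by (rule weighted_block_sum_le[OF p]) auto
      finally show ?thesis .
    qed
    then have "(\<Sum>n<N. norm (dyadic_mean p a n) powr p) \<le> (\<Sum>j<2 ^ N - 1. norm (a j) powr p)"
      unfolding sum_lessThan_blocks by (rule sum_mono)
    also have "\<dots> \<le> ell_norm p a powr p" by (rule ell_sum_le[OF p0 a]) simp
    finally show ?thesis .
  qed
  show "dyadic_mean p a \<in> ell p" "ell_norm p (dyadic_mean p a) \<le> ell_norm p a"
    by (rule ell_memI[OF p0 ell_norm_nonneg le])+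
qed

lemma absorbed_summand_ell:
  assumes "p > 1" "complemented_copy smul (ell p) (ell_norm p) T J"
  shows "absorbed_summand smul (ell p) (ell_norm p) T J (dyadic_spread p) (dyadic_mean p)"
proof -
  have p: "p > 0" using assms(1) by simp
  interpret complemented_copy smul "ell p" "ell_norm p" T J by fact
  show ?thesis
  proof
    show "\<exists>K\<ge>0. \<forall>a\<in>ell p. ell_norm p (dyadic_spread p a :: nat \<Rightarrow> 'a) \<le> K * ell_norm p a"
      by (intro exI[of _ 1]) (simp add: dyadic_spread_ell(2)[OF p])
    show "\<exists>K\<ge>0. \<forall>a\<in>ell p. ell_norm p (dyadic_mean p a :: nat \<Rightarrow> 'a) \<le> K * ell_norm p a"
      by (intro exI[of _ 1]) (simp add: dyadic_mean_ell(2)[OF assms(1)])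
  qed (simp_all add: dyadic_spread_ell(1)[OF p] dyadic_mean_ell(1)[OF assms(1)] dyadic_mean_spread
      fun_eq_iff dyadic_spread_def dyadic_mean_def scaleR_add_right sum.distrib flip: sum_distrib_left)
qed

subsection \<open>The dyadic basis\<close>
text \<open>Counting is enough here: block \<open>n\<close> contributes at most
  \<open>t * weight p n\<close> to the first sum, and these terms grow geometrically with ratio
  2^(1/p), so the sum is comparable with its last term.\<close>

lemma low_level_sums:
  fixes x :: "nat \<Rightarrow> real"
  assumes p: "p > 1" and F: "F \<subseteq> {..<2 ^ N - 1}" and Q: "Q \<ge> 0" and t: "t \<ge> 0"
    and x: "\<And>j. j \<in> F \<Longrightarrow> 0 \<le> x j \<and> x j \<le> t"
    and low: "\<And>n. n < N \<Longrightarrow> t * weight p n \<le> Q"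
  shows "(\<Sum>j\<in>F. weight p (level j) / 2 ^ level j * x j) \<le> 2 powr (1 / p) / (2 powr (1 / p) - 1) * Q"
    and "(\<Sum>j\<in>F. x j powr p) powr (1 / p) \<le> 2 powr (1 / p) * Q"
proof -
  define r where "r = (2::real) powr (1 / p)"
  have r: "r > 1" using p by (simp add: r_def)
  have fin: "finite F" using F finite_subset by blast
  \<comment> \<open>The assumption stops at level \<open>N - 1\<close>; one more ratio reaches
    \<open>N\<close>. A nonempty \<open>F\<close> rules out \<open>N = 0\<close>.\<close>
  have top: "t * weight p N \<le> r * Q" if "F \<noteq> {}"
  proof (cases N)
    case (Suc n)
    have "t * weight p N = r * (t * weight p n)" by (simp add: Suc weight_Suc r_def)
    also have "\<dots> \<le> r * Q" using low[of n] r Suc by (intro mult_left_mono) auto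
    finally show ?thesis .
  qed (use F that in auto)
  have geometric: "(\<Sum>n<N. weight p n) * (r - 1) \<le> weight p N"
  proof -
    have "(\<Sum>n<N. weight p n) * (r - 1) = weight p N - weight p 0"
      by (induction N) (simp_all add: weight_Suc r_def algebra_simps)
    then show ?thesis using weight_pos[of p 0] by simp
  qed
  show "(\<Sum>j\<in>F. weight p (level j) / 2 ^ level j * x j) \<le> 2 powr (1 / p) / (2 powr (1 / p) - 1) * Q"
  proof (cases "F = {}")
    case False
    have "(\<Sum>j\<in>F. weight p (level j) / 2 ^ level j * x j) \<le> (\<Sum>j\<in>F. weight p (level j) / 2 ^ level j * t)"
      using x weight_pos by (intro sum_mono mult_left_mono) (auto simp: less_imp_le)
    also have "\<dots> \<le> (\<Sum>j<2 ^ N - 1. weight p (level j) / 2 ^ level j * t)"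
      using F t weight_pos by (intro sum_mono2) (auto simp: less_imp_le)
    also have "\<dots> = (\<Sum>n<N. \<Sum>j\<in>block n. weight p n / 2 ^ n * t)"
      unfolding sum_lessThan_blocks by (intro sum.cong refl) (simp add: mem_block_iff)
    also have "\<dots> = t * (\<Sum>n<N. weight p n)"
      by (simp add: card_block sum_distrib_left mult.commute)
    also have "\<dots> = t * ((\<Sum>n<N. weight p n) * (r - 1)) / (r - 1)" using r by simp
    also have "\<dots> \<le> t * weight p N / (r - 1)"
      using r t by (intro divide_right_mono mult_left_mono geometric) auto
    also have "\<dots> \<le> r * Q / (r - 1)" using r top[OF False] by (intro divide_right_mono) auto
    finally show ?thesis by (simp add: r_def)
  qed (use r Q in \<open>simp add: r_def\<close>)
  show "(\<Sum>j\<in>F. x j powr p) powr (1 / p) \<le> 2 powr (1 / p) * Q"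
  proof (cases "F = {}")
    case False
    have "card F \<le> 2 ^ N"
      using card_mono[OF _ F] by simp
    then have card: "real (card F) \<le> 2 ^ N" by (metis of_nat_le_iff of_nat_numeral of_nat_power)
    have "(\<Sum>j\<in>F. x j powr p) \<le> (\<Sum>j\<in>F. t powr p)"
      using x p by (intro sum_mono powr_mono2) auto
    also have "\<dots> \<le> 2 ^ N * t powr p" using card by (simp add: mult_right_mono)
    also have "\<dots> = (t * weight p N) powr p"
      using t weight_pos[of p N] weight_powr[of p N] p by (simp add: powr_mult)
    finally have "(\<Sum>j\<in>F. x j powr p) powr (1 / p) \<le> ((t * weight p N) powr p) powr (1 / p)"
      using p by (intro powr_mono2 sum_nonneg) auto
    also have "\<dots> = t * weight p N"
      using t weight_pos[of p N] p by (simp add: powr_powr)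
    finally show ?thesis using top[OF False] by (simp add: r_def)
  qed (use Q in simp)
qed

text \<open>With w the weight at the level of \<open>j\<close>, the term of the first sum is w^(1-p)
  x = x^p (x w)^(1-p). On high levels x w is at least 2 R, so it is at most x^p (2 R)^(1-p): the
  weighted sum is controlled by p-th powers, which \<open>y\<close> bounds.\<close>

lemma high_level_sums:
  fixes x y :: "nat \<Rightarrow> real"
  assumes p: "p > 1" and R: "R > 0"
    and x: "\<And>j. j \<in> F \<Longrightarrow> t \<le> x j \<and> x j \<le> 2 * y j" and t: "t > 0"
    and high: "\<And>j. j \<in> F \<Longrightarrow> 2 * R < t * weight p (level j)"
    and y: "(\<Sum>j\<in>F. y j powr p) \<le> R powr p"
  shows "(\<Sum>j\<in>F. weight p (level j) / 2 ^ level j * x j) \<le> 2 * R"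
    and "(\<Sum>j\<in>F. x j powr p) powr (1 / p) \<le> 2 * R"
proof -
  have powers: "(\<Sum>j\<in>F. x j powr p) \<le> (2 * R) powr p"
  proof -
    have "(\<Sum>j\<in>F. x j powr p) \<le> (\<Sum>j\<in>F. 2 powr p * y j powr p)"
    proof (rule sum_mono)
      fix j assume j: "j \<in> F"
      have "0 \<le> x j" "0 \<le> y j" using x[OF j] t by auto
      then show "x j powr p \<le> 2 powr p * y j powr p"
        using x[OF j] p powr_mono2[of p "x j" "2 * y j"] by (simp add: powr_mult)
    qed
    also have "\<dots> \<le> 2 powr p * R powr p" using y by (simp flip: sum_distrib_left)
    finally show ?thesis using R by (simp add: powr_mult)
  qed
  have "weight p (level j) / 2 ^ level j * x j \<le> x j powr p * (2 * R) powr (1 - p)" if j: "j \<in> F" for j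
  proof -
    define w where "w = weight p (level j)"
    have w: "w > 0" "w powr p = 2 ^ level j" using weight_pos weight_powr p by (auto simp: w_def)
    have xj: "x j > 0" using x[OF j] t by linarith
    have "t * w \<le> x j * w" using x[OF j] w by (intro mult_right_mono) auto
    then have "2 * R \<le> x j * w" using high[OF j] by (simp add: w_def)
    then have "(x j * w) powr (1 - p) \<le> (2 * R) powr (1 - p)"
      using p R by (intro powr_mono2') auto
    then have "x j powr p * (x j * w) powr (1 - p) \<le> x j powr p * (2 * R) powr (1 - p)"
      by (intro mult_left_mono) auto
    moreover have "x j powr p * (x j * w) powr (1 - p) = w / w powr p * x j"
      using xj w by (simp add: powr_mult powr_diff)
    ultimately show ?thesis unfolding w(2) by (simp add: w_def)
  qed
  then have "(\<Sum>j\<in>F. weight p (level j) / 2 ^ level j * x j) \<le> (\<Sum>j\<in>F. x j powr p) * (2 * R) powr (1 - p)"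
    unfolding sum_distrib_right by (rule sum_mono)
  also have "\<dots> \<le> (2 * R) powr p * (2 * R) powr (1 - p)"
    by (intro mult_right_mono powers) auto
  also have "\<dots> = 2 * R" using R by (simp flip: powr_add)
  finally show "(\<Sum>j\<in>F. weight p (level j) / 2 ^ level j * x j) \<le> 2 * R" .
  have "(\<Sum>j\<in>F. x j powr p) powr (1 / p) \<le> ((2 * R) powr p) powr (1 / p)"
    using p by (intro powr_mono2 powers sum_nonneg) auto
  also have "\<dots> = 2 * R" using p R by (simp add: powr_powr)
  finally show "(\<Sum>j\<in>F. x j powr p) powr (1 / p) \<le> 2 * R" .
qed

section \<open>The new vectors and their coefficient functionals\<close>

locale dyadic_basis =
  absorbed_summand smul "ell p" "ell_norm p" T J "dyadic_spread p" "dyadic_mean p"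
  for smul :: "'k::real_or_complex_field \<Rightarrow> 'a::banach \<Rightarrow> 'a" and p T J +
  fixes z :: "nat \<Rightarrow> 'a" and B :: real
  assumes p: "1 < p" and z: "schauder_basis smul z" and B: "B > 0"
    and z_le: "norm (z n) \<le> B" and coord_z_le: "norm (coord smul z n f) \<le> B * norm f"
begin

text \<open>The projection onto the copy of the sequences with mean zero on each block, along the
  range of \<open>emb\<close>.\<close>

definition D :: "'a \<Rightarrow> 'a" where "D g = g - emb (ext g)"

definition unit :: "nat \<Rightarrow> nat \<Rightarrow> 'k" where "unit j i = (if i = j then 1 else 0)"

text \<open>The \<open>2 ^ n\<close> vectors of block \<open>n\<close> span \<open>emb (z n)\<close> together with the mean-zero part of that
  block in the copy of \<open>ell p\<close>; each of them carries an equal share of \<open>emb (z n)\<close>.\<close>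

definition \<psi> :: "nat \<Rightarrow> 'a" where
  "\<psi> j = (weight p (level j) / 2 ^ level j) *\<^sub>R emb (z (level j)) + D (T (unit j))"

text \<open>This is the mean of the coefficients \<open>\<psi>_dual j f\<close> over block
  \<open>n\<close>; \<open>res (J f) j\<close> is the deviation from it, by
  \<open>sum_block_res\<close>.\<close>

definition \<alpha> :: "nat \<Rightarrow> 'a \<Rightarrow> 'k" where
  "\<alpha> n f = (1 / weight p n) *\<^sub>R coord smul z n (ext f)"

definition \<psi>_dual :: "nat \<Rightarrow> 'a \<Rightarrow> 'k" where
  "\<psi>_dual j f = \<alpha> (level j) f + res (J f) j"

lemma p_pos: "p > 0" using p by simp

lemma D_res: "D g = T (res (J g))"
  by (simp add: D_def emb_ext)

lemma D_T: "a \<in> ell p \<Longrightarrow> D (T a) = T (res a)"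
  by (simp add: D_res J_T)

lemma D_linear: "bounded_linear D"
  unfolding D_def[abs_def]
  by (intro bounded_linear_sub bounded_linear_ident bounded_linear_compose[OF emb_linear ext_linear])

lemma D_scale: "D (smul c g) = smul c (D g)"
  by (simp add: D_def ext_scale emb_scale scale_right_diff_distrib)

lemma ext_D: "ext (D g) = 0"
  by (simp add: D_def linear_diff[OF bounded_linear.linear[OF ext_linear]] ext_emb)

lemma D_emb: "D (emb g) = 0"
  by (simp add: D_def ext_emb)

lemma D_D: "D (D g) = D g"
  by (simp add: D_def[of "D g"] ext_D linear_0[OF bounded_linear.linear[OF emb_linear]])

lemma unit_ell: "unit j \<in> ell p"
  by (rule ell_finite_support(1)[OF p_pos, of "{j}"]) (auto simp: unit_def)

lemma combination_eq:
  assumes "finite F"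
  shows "(\<Sum>j\<in>F. smul (a j) (\<psi> j)) =
    (\<Sum>j\<in>F. smul ((weight p (level j) / 2 ^ level j) *\<^sub>R a j) (emb (z (level j))))
      + D (T (\<lambda>i. if i \<in> F then a i else 0))"
proof -
  have "(\<lambda>i. if i \<in> F then a i else 0) = (\<lambda>i. \<Sum>j\<in>F. a j * unit j i)"
    using assms by (simp add: unit_def fun_eq_iff if_distrib sum.delta' cong: if_cong)
  then have "T (\<lambda>i. if i \<in> F then a i else 0) = (\<Sum>j\<in>F. smul (a j) (T (unit j)))"
    by (simp only:) (rule T_linear_combination, rule unit_ell)
  then have "D (T (\<lambda>i. if i \<in> F then a i else 0)) = (\<Sum>j\<in>F. smul (a j) (D (T (unit j))))"
    by (simp add: linear_sum[OF bounded_linear.linear[OF D_linear]] D_scale)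
  then show ?thesis
    by (simp add: \<psi>_def scale_right_distrib sum.distrib smul.scaleR_left smul.scaleR_right)
qed

text \<open>No cancellation among the conditional vectors \<open>z n\<close> can be relied on, so
  their part is estimated by the triangle inequality, which gives the weighted sum. The mean-zero
  part is estimated in \<open>ell p\<close>.\<close>

lemma combination_bound:
  "\<exists>C>0. \<forall>F a. finite F \<longrightarrow> norm (\<Sum>j\<in>F. smul (a j) (\<psi> j)) \<le>
     C * (\<Sum>j\<in>F. weight p (level j) / 2 ^ level j * norm (a j)) + C * (\<Sum>j\<in>F. norm (a j) powr p) powr (1 / p)"
proof -
  obtain Ke where Ke: "\<And>f. norm (emb f) \<le> norm f * Ke" "Ke \<ge> 0"
    using bounded_linear.nonneg_bounded[OF emb_linear] by blast
  obtain KD where KD: "\<And>f. norm (D f) \<le> norm f * KD" "KD \<ge> 0"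
    using bounded_linear.nonneg_bounded[OF D_linear] by blast
  obtain KT where KT: "KT \<ge> 0" "\<And>a. a \<in> ell p \<Longrightarrow> norm (T a) \<le> KT * ell_norm p a"
    using T_bounded by blast
  define C where "C = B * Ke + KT * KD + 1"
  have C: "B * Ke \<le> C" "KT * KD \<le> C" "C > 0"
    using mult_nonneg_nonneg[OF less_imp_le[OF B] Ke(2)] mult_nonneg_nonneg[OF KT(1) KD(2)]
    by (simp_all add: C_def)
  have "norm (\<Sum>j\<in>F. smul (a j) (\<psi> j)) \<le>
     C * (\<Sum>j\<in>F. weight p (level j) / 2 ^ level j * norm (a j)) + C * (\<Sum>j\<in>F. norm (a j) powr p) powr (1 / p)"
    if F: "finite F" for F a
  proof -
    let ?w = "\<lambda>j. weight p (level j) / 2 ^ level j"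
    let ?a = "\<lambda>i. if i \<in> F then a i else 0"
    have w: "?w j \<ge> 0" for j using weight_pos[of p "level j"] by simp
    have "norm (\<Sum>j\<in>F. smul (?w j *\<^sub>R a j) (emb (z (level j)))) \<le> (\<Sum>j\<in>F. ?w j * norm (a j) * (B * Ke))"
    proof (rule sum_norm_le)
      fix j
      have "norm (emb (z (level j))) \<le> B * Ke"
        using order_trans[OF Ke(1) mult_right_mono[OF z_le Ke(2)]] .
      then have "?w j * norm (a j) * norm (emb (z (level j))) \<le> ?w j * norm (a j) * (B * Ke)"
        by (intro mult_left_mono mult_nonneg_nonneg w) auto
      then show "norm (smul (?w j *\<^sub>R a j) (emb (z (level j)))) \<le> ?w j * norm (a j) * (B * Ke)"
        unfolding norm_scale norm_scaleR abs_of_nonneg[OF w] .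
    qed
    also have "\<dots> = B * Ke * (\<Sum>j\<in>F. ?w j * norm (a j))"
      by (simp add: sum_distrib_left mult_ac)
    also have "\<dots> \<le> C * (\<Sum>j\<in>F. ?w j * norm (a j))"
      by (intro mult_right_mono C sum_nonneg mult_nonneg_nonneg w) auto
    finally have 1: "norm (\<Sum>j\<in>F. smul (?w j *\<^sub>R a j) (emb (z (level j)))) \<le> C * (\<Sum>j\<in>F. ?w j * norm (a j))" .
    have "norm (D (T ?a)) \<le> norm (T ?a) * KD" by (rule KD(1))
    also have "\<dots> \<le> KT * ell_norm p ?a * KD"
      by (intro mult_right_mono KT(2) KD(2) ell_finite_support(1)[OF p_pos F]) auto
    also have "\<dots> = KT * KD * ell_norm p ?a" by simp
    also have "\<dots> \<le> C * ell_norm p ?a" by (intro mult_right_mono C ell_norm_nonneg)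
    also have "\<dots> \<le> C * (\<Sum>j\<in>F. norm (?a j) powr p) powr (1 / p)"
      using C(3) by (intro mult_left_mono ell_finite_support(2)[OF p_pos F]) auto
    also have "(\<Sum>j\<in>F. norm (?a j) powr p) = (\<Sum>j\<in>F. norm (a j) powr p)"
      by (rule sum.cong) auto
    finally have 2: "norm (D (T ?a)) \<le> C * (\<Sum>j\<in>F. norm (a j) powr p) powr (1 / p)" .
    show ?thesis
      unfolding combination_eq[OF F] by (rule order_trans[OF norm_triangle_ineq add_mono[OF 1 2]])
  qed
  then show ?thesis using C(3) by blast
qed

text \<open>Within one block the weighted sum is dominated by the \<open>ell p\<close> norm. With
  \<open>block_dual_bound\<close> this makes all projections inside a block uniformly
  bounded.\<close>

lemma block_combination_bound:
  "\<exists>C>0. \<forall>F a n. F \<subseteq> block n \<longrightarrow>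
     norm (\<Sum>j\<in>F. smul (a j) (\<psi> j)) \<le> C * (\<Sum>j\<in>F. norm (a j) powr p) powr (1 / p)"
proof -
  obtain C where C: "C > 0" "\<And>F a. finite F \<Longrightarrow> norm (\<Sum>j\<in>F. smul (a j) (\<psi> j)) \<le>
     C * (\<Sum>j\<in>F. weight p (level j) / 2 ^ level j * norm (a j)) + C * (\<Sum>j\<in>F. norm (a j) powr p) powr (1 / p)"
    using combination_bound by blast
  have "norm (\<Sum>j\<in>F. smul (a j) (\<psi> j)) \<le> 2 * C * (\<Sum>j\<in>F. norm (a j) powr p) powr (1 / p)"
    if F: "F \<subseteq> block n" for F n and a :: "nat \<Rightarrow> 'k"
  proof -
    have fin: "finite F" using F finite_block finite_subset by blast
    let ?s = "\<Sum>j\<in>F. weight p (level j) / 2 ^ level j * norm (a j)"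
    have s: "?s = weight p n / 2 ^ n * (\<Sum>j\<in>F. norm (a j))"
      unfolding sum_distrib_left using F by (intro sum.cong refl) (auto simp: mem_block_iff)
    have "?s \<ge> 0" using weight_pos by (intro sum_nonneg) (simp add: less_imp_le)
    then have "?s = (?s powr p) powr (1 / p)" using p by (simp add: powr_powr)
    also have "\<dots> \<le> (\<Sum>j\<in>F. norm (a j) powr p) powr (1 / p)"
      unfolding s using p F by (intro powr_mono2 weighted_block_sum_le) auto
    finally have "C * ?s \<le> C * (\<Sum>j\<in>F. norm (a j) powr p) powr (1 / p)"
      using C(1) by (intro mult_left_mono) auto
    then show ?thesis using C(2)[OF fin, of a] by linarith
  qed
  then show ?thesis using C(1) by (intro exI[of _ "2 * C"]) auto
qed

lemma parameter_bound:
  "\<exists>C>0. \<forall>f. (\<forall>n. weight p n * norm (\<alpha> n f) \<le> C * norm f) \<and> ell_norm p (res (J f)) \<le> C * norm f"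
proof -
  obtain Kx where Kx: "\<And>f. norm (ext f) \<le> norm f * Kx" "Kx \<ge> 0"
    using bounded_linear.nonneg_bounded[OF ext_linear] by blast
  obtain KD where KD: "\<And>f. norm (D f) \<le> norm f * KD" "KD \<ge> 0"
    using bounded_linear.nonneg_bounded[OF D_linear] by blast
  obtain KJ where KJ: "KJ \<ge> 0" "\<And>f. ell_norm p (J f) \<le> KJ * norm f" using J_bounded by blast
  define C where "C = B * Kx + KJ * KD + 1"
  have C: "B * Kx \<le> C" "KJ * KD \<le> C" "C > 0"
    using mult_nonneg_nonneg[OF less_imp_le[OF B] Kx(2)] mult_nonneg_nonneg[OF KJ(1) KD(2)]
    by (simp_all add: C_def)
  have "weight p n * norm (\<alpha> n f) \<le> C * norm f" for n f
  proof -
    have "weight p n * norm (\<alpha> n f) = norm (coord smul z n (ext f))"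
      using weight_pos[of p n] by (simp add: \<alpha>_def)
    also have "\<dots> \<le> B * (norm f * Kx)"
      using order_trans[OF coord_z_le mult_left_mono[OF Kx(1)]] B by simp
    also have "\<dots> = B * Kx * norm f" by simp
    also have "\<dots> \<le> C * norm f" by (intro mult_right_mono C) simp
    finally show ?thesis .
  qed
  moreover have "ell_norm p (res (J f)) \<le> C * norm f" for f
  proof -
    have "res (J f) = J (D f)" by (simp add: D_res J_T res_mem J_mem)
    then have "ell_norm p (res (J f)) \<le> KJ * (norm f * KD)"
      using order_trans[OF KJ(2) mult_left_mono[OF KD(1) KJ(1)]] by simp
    also have "\<dots> = KJ * KD * norm f" by simp
    also have "\<dots> \<le> C * norm f" by (intro mult_right_mono C) simp
    finally show ?thesis .
  qed
  ultimately show ?thesis using C(3) by blast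
qed

lemma res_apply: "res a j = a j - (1 / 2 ^ level j) *\<^sub>R (\<Sum>i\<in>block (level j). a i)"
  by (simp add: res_def dyadic_spread_mean)

lemma sum_block_res: "(\<Sum>j\<in>block n. res a j) = 0"
  using fun_cong[OF u'_res[of a], of n] weight_pos[of p n] by (simp add: dyadic_mean_def)

lemma block_dual_powr_le:
  "(\<Sum>j\<in>block n. norm (\<psi>_dual j f) powr p)
    \<le> 2 powr p * ((weight p n * norm (\<alpha> n f)) powr p + (\<Sum>j\<in>block n. norm (res (J f) j) powr p))"
proof -
  have "(\<Sum>j\<in>block n. norm (\<psi>_dual j f) powr p)
      \<le> (\<Sum>j\<in>block n. 2 powr p * (norm (\<alpha> n f) powr p + norm (res (J f) j) powr p))"
  proof (rule sum_mono)
    fix j assume j: "j \<in> block n"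
    have "norm (\<psi>_dual j f) \<le> norm (\<alpha> n f) + norm (res (J f) j)"
      using j by (simp add: \<psi>_dual_def mem_block_iff norm_triangle_ineq)
    then have "norm (\<psi>_dual j f) powr p \<le> (norm (\<alpha> n f) + norm (res (J f) j)) powr p"
      using p by (intro powr_mono2) auto
    also have "\<dots> \<le> 2 powr p * (norm (\<alpha> n f) powr p + norm (res (J f) j) powr p)"
      by (rule powr_add_le) (auto simp: p_pos)
    finally show "norm (\<psi>_dual j f) powr p \<le> 2 powr p * (norm (\<alpha> n f) powr p + norm (res (J f) j) powr p)" .
  qed
  also have "\<dots> = 2 powr p * (2 ^ n * norm (\<alpha> n f) powr p + (\<Sum>j\<in>block n. norm (res (J f) j) powr p))"
    by (simp add: sum.distrib card_block flip: sum_distrib_left)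
  also have "2 ^ n * norm (\<alpha> n f) powr p = (weight p n * norm (\<alpha> n f)) powr p"
    using weight_pos[of p n] weight_powr[OF p_pos, of n] by (simp add: powr_mult)
  finally show ?thesis .
qed

lemma block_dual_bound:
  "\<exists>C>0. \<forall>f n. (\<Sum>j\<in>block n. norm (\<psi>_dual j f) powr p) powr (1 / p) \<le> C * norm f"
proof -
  obtain C where C: "C > 0" "\<And>f n. weight p n * norm (\<alpha> n f) \<le> C * norm f"
      "\<And>f. ell_norm p (res (J f)) \<le> C * norm f"
    using parameter_bound by blast
  have "(\<Sum>j\<in>block n. norm (\<psi>_dual j f) powr p) powr (1 / p) \<le> 4 * C * norm f" for f n
  proof -
    have nonneg: "C * norm f \<ge> 0" using C(1) by simp
    have 1: "(weight p n * norm (\<alpha> n f)) powr p \<le> (C * norm f) powr p"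
      using p weight_pos[of p n] by (intro powr_mono2 C) auto
    have 2: "(\<Sum>j\<in>block n. norm (res (J f) j) powr p) \<le> (C * norm f) powr p"
      using order_trans[OF ell_sum_le[OF p_pos res_mem[OF J_mem] finite_block]
          powr_mono2[OF _ ell_norm_nonneg C(3)]] p by simp
    have "(\<Sum>j\<in>block n. norm (\<psi>_dual j f) powr p) \<le> 2 powr p * (2 * (C * norm f) powr p)"
      using order_trans[OF block_dual_powr_le mult_left_mono[OF add_mono[OF 1 2]]] by simp
    \<comment> \<open>Replacing 2 by \<open>2 powr p\<close> turns the bound into a pure p-th power,
      with base constant 2 * 2.\<close>
    also have "\<dots> \<le> 2 powr p * (2 powr p * (C * norm f) powr p)"
      using p powr_mono[of 1 p 2] by (intro mult_left_mono mult_right_mono) auto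
    also have "\<dots> = (4 * C * norm f) powr p"
    proof -
      have "4 * C * norm f = 2 * (2 * (C * norm f))" by simp
      then show ?thesis using nonneg by (simp only: powr_mult mult_nonneg_nonneg zero_le_numeral)
    qed
    finally have "(\<Sum>j\<in>block n. norm (\<psi>_dual j f) powr p) powr (1 / p) \<le> ((4 * C * norm f) powr p) powr (1 / p)"
      using p by (intro powr_mono2 sum_nonneg) auto
    also have "\<dots> = 4 * C * norm f" using p C(1) by (simp add: powr_powr)
    finally show ?thesis .
  qed
  then show ?thesis using C(1) by (intro exI[of _ "4 * C"]) auto
qed

lemma \<psi>_dual_bound: "\<exists>C>0. \<forall>f j. norm (\<psi>_dual j f) \<le> C * norm f"
proof -
  obtain C where C: "C > 0" "\<And>f n. (\<Sum>j\<in>block n. norm (\<psi>_dual j f) powr p) powr (1 / p) \<le> C * norm f"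
    using block_dual_bound by blast
  have "norm (\<psi>_dual j f) \<le> C * norm f" for f j
  proof -
    have "norm (\<psi>_dual j f) = (norm (\<psi>_dual j f) powr p) powr (1 / p)" using p by (simp add: powr_powr)
    also have "\<dots> \<le> (\<Sum>i\<in>block (level j). norm (\<psi>_dual i f) powr p) powr (1 / p)"
      using p member_le_sum[of j "block (level j)" "\<lambda>i. norm (\<psi>_dual i f) powr p"]
      by (intro powr_mono2) (auto simp: mem_block_iff)
    also have "\<dots> \<le> C * norm f" by (rule C(2))
    finally show ?thesis .
  qed
  then show ?thesis using C(1) by blast
qed

lemma \<psi>_dual_functional: "bounded_functional (\<psi>_dual j)"
  unfolding bounded_functional_def
proof (intro conjI allI)
  show "\<psi>_dual j (f + g) = \<psi>_dual j f + \<psi>_dual j g" for f g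
    by (simp add: \<psi>_dual_def \<alpha>_def linear_add[OF bounded_linear.linear[OF ext_linear]] coord_add[OF z] res_apply J_add
        sum.distrib scaleR_add_right)
  show "\<psi>_dual j (smul c f) = c * \<psi>_dual j f" for c f
    by (simp add: \<psi>_dual_def \<alpha>_def ext_scale coord_scale[OF z] res_apply J_scale algebra_simps
        flip: sum_distrib_left)
  show "\<exists>K. \<forall>f. norm (\<psi>_dual j f) \<le> K * norm f" using \<psi>_dual_bound by blast
qed

text \<open>Passing to \<open>D (T (unit j))\<close> removes the block mean 1/2^n from
  \<open>unit j\<close>, and the share of \<open>emb (z n)\<close> puts exactly this amount back.
  This dictates the coefficient of \<open>emb (z n)\<close> in \<open>\<psi>\<close>.\<close>

lemma \<psi>_biorthogonal: "\<psi>_dual i (\<psi> j) = (if i = j then 1 else 0)"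
proof -
  have ext: "ext (\<psi> j) = (weight p (level j) / 2 ^ level j) *\<^sub>R z (level j)"
    by (simp add: \<psi>_def linear_add[OF bounded_linear.linear[OF ext_linear]] linear_scale[OF bounded_linear.linear[OF ext_linear]] ext_emb ext_D)
  have \<alpha>: "\<alpha> (level i) (\<psi> j) = (if level i = level j then (1 / 2 ^ level i) *\<^sub>R 1 else 0)"
    using weight_pos[of p "level i"] weight_pos[of p "level j"]
    by (simp add: \<alpha>_def ext coord_basis[OF z]
        linear_scale[OF bounded_linear.linear[OF bounded_functional_imp[OF coord_functional[OF z]]]])
  have "D (\<psi> j) = D (T (unit j))"
    by (simp add: \<psi>_def linear_add[OF bounded_linear.linear[OF D_linear]] linear_scale[OF bounded_linear.linear[OF D_linear]] D_emb D_D)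
  then have "T (res (J (\<psi> j))) = T (res (unit j))"
    by (simp add: D_T unit_ell) (simp add: D_res)
  then have "J (T (res (J (\<psi> j)))) = J (T (res (unit j)))" by simp
  then have "res (J (\<psi> j)) = res (unit j)"
    by (simp add: J_T res_mem J_mem unit_ell)
  then have "res (J (\<psi> j)) i = unit j i - (1 / 2 ^ level i) *\<^sub>R (\<Sum>k\<in>block (level i). unit j k)"
    by (simp add: res_apply)
  also have "(\<Sum>k\<in>block (level i). unit j k) = (if level i = level j then 1 else 0)"
    by (auto simp: unit_def mem_block_iff)
  finally show ?thesis by (simp add: \<psi>_dual_def \<alpha> unit_def)
qed

text \<open>A uniform bound per block does not make partial sums ending inside a block converge; the
  contribution of the incomplete block has to vanish.\<close>

lemma block_dual_tendsto:
  "(\<lambda>n. (\<Sum>j\<in>block n. norm (\<psi>_dual j f) powr p) powr (1 / p)) \<longlonglongrightarrow> 0"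
proof -
  have "(\<lambda>n. norm (coord smul z n (ext f))) \<longlonglongrightarrow> 0"
  proof (rule Lim_null_comparison[of _ "\<lambda>n. B * norm (smul (coord smul z n (ext f)) (z n))"])
    have "norm (coord smul z n (ext f)) \<le> B * norm (smul (coord smul z n (ext f)) (z n))" for n
    proof -
      \<comment> \<open>The bound on the coordinate functionals, tested on \<open>z n\<close>, keeps
        the norms of the \<open>z n\<close> away from zero.\<close>
      have "1 \<le> B * norm (z n)" using coord_z_le[of n "z n"] by (simp add: coord_basis[OF z])
      then have "norm (coord smul z n (ext f)) * 1 \<le> norm (coord smul z n (ext f)) * (B * norm (z n))"
        by (intro mult_left_mono) auto
      then show ?thesis by (simp add: norm_scale mult_ac)
    qed
    then show "\<forall>\<^sub>F n in sequentially. norm (norm (coord smul z n (ext f))) \<le> B * norm (smul (coord smul z n (ext f)) (z n))"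
      by simp
    show "(\<lambda>n. B * norm (smul (coord smul z n (ext f)) (z n))) \<longlonglongrightarrow> 0"
      by (intro tendsto_mult_right_zero tendsto_norm_zero summable_LIMSEQ_zero sums_summable[OF coord_sums[OF z]])
  qed
  moreover have "weight p n * norm (\<alpha> n f) = norm (coord smul z n (ext f))" for n
    using weight_pos[of p n] by (simp add: \<alpha>_def)
  ultimately have "(\<lambda>n. weight p n * norm (\<alpha> n f)) \<longlonglongrightarrow> 0" by simp
  then have 1: "(\<lambda>n. (weight p n * norm (\<alpha> n f)) powr p) \<longlonglongrightarrow> 0"
    using p weight_pos by (intro tendsto_zero_powrI[where b = p]) (auto simp: less_imp_le)
  have 2: "(\<lambda>n. \<Sum>j\<in>block n. norm (res (J f) j) powr p) \<longlonglongrightarrow> 0"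
  proof -
    let ?S = "\<lambda>N. \<Sum>j<N. norm (res (J f) j) powr p"
    have "summable (\<lambda>j. norm (res (J f) j) powr p)" using res_mem[OF J_mem] by (simp add: ell_def)
    then have S: "?S \<longlonglongrightarrow> (\<Sum>j. norm (res (J f) j) powr p)" by (rule summable_LIMSEQ)
    have "filterlim (\<lambda>n. 2 ^ n - 1 :: nat) at_top sequentially"
      unfolding filterlim_at_top eventually_sequentially
    proof (intro allI exI impI)
      fix Z n :: nat assume "Z \<le> n"
      then show "Z \<le> 2 ^ n - 1" using less_exp[of n] by linarith
    qed
    then have lim: "(\<lambda>n. ?S (2 ^ n - 1)) \<longlonglongrightarrow> (\<Sum>j. norm (res (J f) j) powr p)"
      by (rule filterlim_compose[OF S])
    have "(\<lambda>n. ?S (2 ^ Suc n - 1) - ?S (2 ^ n - 1)) \<longlonglongrightarrow> 0"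
      using tendsto_diff[OF LIMSEQ_Suc[OF lim] lim] by simp
    then show ?thesis unfolding sum_lessThan_blocks by simp
  qed
  have "(\<lambda>n. 2 powr p * ((weight p n * norm (\<alpha> n f)) powr p + (\<Sum>j\<in>block n. norm (res (J f) j) powr p))) \<longlonglongrightarrow> 0"
    using tendsto_mult_right_zero[OF tendsto_add_zero[OF 1 2]] .
  then have "(\<lambda>n. \<Sum>j\<in>block n. norm (\<psi>_dual j f) powr p) \<longlonglongrightarrow> 0"
  proof (rule Lim_null_comparison[rotated], intro always_eventually allI)
    fix n
    have "(\<Sum>j\<in>block n. norm (\<psi>_dual j f) powr p) \<ge> 0" by (intro sum_nonneg) simp
    then show "norm (\<Sum>j\<in>block n. norm (\<psi>_dual j f) powr p)
        \<le> 2 powr p * ((weight p n * norm (\<alpha> n f)) powr p + (\<Sum>j\<in>block n. norm (res (J f) j) powr p))"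
      using block_dual_powr_le[where n = n and f = f] by simp
  qed
  then show ?thesis
    using p by (intro tendsto_zero_powrI[where b = "1 / p"]) (auto intro!: always_eventually sum_nonneg)
qed

text \<open>Truncation at the end of a block commutes with block means. The shares of each
  \<open>emb (z n)\<close> then add up completely, and the sum splits into a partial sum for
  \<open>z\<close> and a truncation in \<open>ell p\<close>.\<close>

lemma partial_sum_blocks:
  "(\<Sum>j<2 ^ N - 1. smul (\<psi>_dual j f) (\<psi> j)) =
     (\<Sum>n<N. smul (coord smul z n (ext f)) (emb (z n))) + T (\<lambda>i. if i < 2 ^ N - 1 then res (J f) i else 0)"
proof -
  let ?x = "\<lambda>i. if i \<in> {..<2 ^ N - 1} then \<psi>_dual i f else 0"
  have block_sum: "(\<Sum>j\<in>block n. \<psi>_dual j f) = 2 ^ n * \<alpha> n f" for n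
  proof -
    have "(\<Sum>j\<in>block n. \<psi>_dual j f) = (\<Sum>j\<in>block n. \<alpha> n f + res (J f) j)"
      by (rule sum.cong) (auto simp: \<psi>_dual_def mem_block_iff)
    then show ?thesis by (simp add: sum.distrib sum_block_res card_block)
  qed
  have "(\<Sum>j\<in>block n. smul ((weight p (level j) / 2 ^ level j) *\<^sub>R \<psi>_dual j f) (emb (z (level j))))
      = smul (coord smul z n (ext f)) (emb (z n))" for n
  proof -
    have "(\<Sum>j\<in>block n. smul ((weight p (level j) / 2 ^ level j) *\<^sub>R \<psi>_dual j f) (emb (z (level j))))
        = smul ((weight p n / 2 ^ n) *\<^sub>R (\<Sum>j\<in>block n. \<psi>_dual j f)) (emb (z n))"
      unfolding scaleR_sum_right scale_sum_left by (rule sum.cong) (auto simp: mem_block_iff)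
    also have "(weight p n / 2 ^ n) *\<^sub>R (\<Sum>j\<in>block n. \<psi>_dual j f) = coord smul z n (ext f)"
      unfolding block_sum \<alpha>_def using weight_pos[of p n] by (simp add: scaleR_conv_of_real)
    finally show ?thesis .
  qed
  then have 1: "(\<Sum>j<2 ^ N - 1. smul ((weight p (level j) / 2 ^ level j) *\<^sub>R \<psi>_dual j f) (emb (z (level j))))
      = (\<Sum>n<N. smul (coord smul z n (ext f)) (emb (z n)))"
    unfolding sum_lessThan_blocks by simp
  have "res ?x = (\<lambda>i. if i < 2 ^ N - 1 then res (J f) i else 0)"
  proof
    fix i
    have "(\<Sum>k\<in>block (level i). ?x k) = (\<Sum>k\<in>block (level i). if level i < N then \<psi>_dual k f else 0)"
      by (rule sum.cong) (simp_all only: lessThan_iff mem_block_iff level_less_iff[symmetric])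
    also have "\<dots> = (if level i < N then (\<Sum>k\<in>block (level i). \<psi>_dual k f) else 0)" by simp
    finally have sum: "(\<Sum>k\<in>block (level i). ?x k) = (if level i < N then (\<Sum>k\<in>block (level i). \<psi>_dual k f) else 0)" .
    show "res ?x i = (if i < 2 ^ N - 1 then res (J f) i else 0)"
      unfolding res_apply[of ?x] sum unfolding lessThan_iff level_less_iff[symmetric]
      by (simp add: block_sum scaleR_conv_of_real) (simp add: \<psi>_dual_def)
  qed
  moreover have "?x \<in> ell p"
    by (rule ell_finite_support(1)[OF p_pos, of "{..<2 ^ N - 1}"]) auto
  ultimately have 2: "D (T ?x) = T (\<lambda>i. if i < 2 ^ N - 1 then res (J f) i else 0)"
    by (simp only: D_T)
  show ?thesis unfolding combination_eq[OF finite_lessThan] 1 2 ..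
qed

text \<open>Along block ends the two pieces of \<open>partial_sum_blocks\<close> converge
  separately. Any other partial sum differs from the preceding block end by a piece of one block,
  which tends to zero.\<close>

lemma \<psi>_sums: "(\<lambda>j. smul (\<psi>_dual j f) (\<psi> j)) sums f"
proof -
  let ?S = "\<lambda>N. \<Sum>j<N. smul (\<psi>_dual j f) (\<psi> j)"
  obtain KT where KT: "KT \<ge> 0" "\<And>a. a \<in> ell p \<Longrightarrow> norm (T a) \<le> KT * ell_norm p a"
    using T_bounded by blast
  have exp_top: "filterlim (\<lambda>n. 2 ^ n - 1 :: nat) at_top sequentially"
    unfolding filterlim_at_top eventually_sequentially
  proof (intro allI exI impI)
    fix Z n :: nat assume "Z \<le> n"
    then show "Z \<le> 2 ^ n - 1" using less_exp[of n] by linarith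
  qed
  have blocks: "(\<lambda>n. ?S (2 ^ n - 1)) \<longlonglongrightarrow> f"
  proof -
    have "(\<lambda>n. smul (coord smul z n (ext f)) (emb (z n))) sums emb (ext f)"
      using bounded_linear.sums[OF emb_linear coord_sums[OF z, of "ext f"]] by (simp add: emb_scale)
    then have 1: "(\<lambda>N. \<Sum>n<N. smul (coord smul z n (ext f)) (emb (z n))) \<longlonglongrightarrow> emb (ext f)"
      by (simp add: sums_def)
    have r: "res (J f) \<in> ell p" by (intro res_mem J_mem)
    have trunc: "(\<lambda>i. if i < M then res (J f) i else 0) \<in> ell p" for M
      by (rule ell_finite_support(1)[OF p_pos, of "{..<M}"]) auto
    have "(\<lambda>M. T (\<lambda>i. if i < M then res (J f) i else 0) - T (res (J f))) \<longlonglongrightarrow> 0"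
    proof (rule Lim_null_comparison)
      show "(\<lambda>M. KT * ell_norm p (\<lambda>i. if i < M then 0 else res (J f) i)) \<longlonglongrightarrow> 0"
        by (intro tendsto_mult_right_zero ell_norm_tail p_pos r)
      have "norm (T (\<lambda>i. if i < M then res (J f) i else 0) - T (res (J f)))
          \<le> KT * ell_norm p (\<lambda>i. if i < M then 0 else res (J f) i)" for M
      proof -
        have eq: "(\<lambda>i. res (J f) i - (if i < M then res (J f) i else 0)) = (\<lambda>i. if i < M then 0 else res (J f) i)"
          by auto
        have tail: "T (\<lambda>i. if i < M then 0 else res (J f) i) = T (res (J f)) - T (\<lambda>i. if i < M then res (J f) i else 0)"
          using T_diff[OF r trunc[of M]] unfolding eq .
        have "(\<lambda>i. if i < M then 0 else res (J f) i) \<in> ell p"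
          using S_diff[OF r trunc[of M]] unfolding eq .
        from KT(2)[OF this] show ?thesis
          unfolding tail by (simp only: norm_minus_commute)
      qed
      then show "\<forall>\<^sub>F M in sequentially. norm (T (\<lambda>i. if i < M then res (J f) i else 0) - T (res (J f)))
          \<le> KT * ell_norm p (\<lambda>i. if i < M then 0 else res (J f) i)" by simp
    qed
    then have "(\<lambda>M. T (\<lambda>i. if i < M then res (J f) i else 0)) \<longlonglongrightarrow> T (res (J f))"
      by (rule LIM_zero_cancel)
    then have 2: "(\<lambda>N. T (\<lambda>i. if i < 2 ^ N - 1 then res (J f) i else 0)) \<longlonglongrightarrow> T (res (J f))"
      by (rule filterlim_compose[OF _ exp_top])
    have "emb (ext f) + T (res (J f)) = f" by (simp add: emb_ext)
    then show ?thesis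
      using tendsto_add[OF 1 2] unfolding partial_sum_blocks by simp
  qed
  have level_top: "filterlim level at_top sequentially"
    unfolding filterlim_at_top eventually_sequentially
  proof (intro allI exI impI)
    fix Z n :: nat assume "2 ^ Z - 1 \<le> n"
    then show "Z \<le> level n" using level_less_iff[of n Z] by linarith
  qed
  obtain C where C: "C > 0" "\<And>F a n. F \<subseteq> block n \<Longrightarrow>
     norm (\<Sum>j\<in>F. smul (a j) (\<psi> j)) \<le> C * (\<Sum>j\<in>F. norm (a j) powr p) powr (1 / p)"
    using block_combination_bound by blast
  let ?e = "\<lambda>n. (\<Sum>j\<in>block n. norm (\<psi>_dual j f) powr p) powr (1 / p)"
  have within: "norm (?S N - ?S (2 ^ level N - 1)) \<le> C * ?e (level N)" for N
  proof -
    define M where "M = (2::nat) ^ level N - 1"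
    have M: "M \<le> N" using level_less_iff[of N "level N"] by (simp add: M_def)
    have sub: "{M..<N} \<subseteq> block (level N)"
      using level_less_iff[of N "Suc (level N)"] by (auto simp: block_def M_def)
    have "?S N - ?S M = (\<Sum>j\<in>{M..<N}. smul (\<psi>_dual j f) (\<psi> j))"
      using sum_diff_nat_ivl[of 0 M N "\<lambda>j. smul (\<psi>_dual j f) (\<psi> j)"] M by (simp add: lessThan_atLeast0)
    then have "norm (?S N - ?S M) \<le> C * (\<Sum>j\<in>{M..<N}. norm (\<psi>_dual j f) powr p) powr (1 / p)"
      using C(2)[OF sub] by simp
    also have "\<dots> \<le> C * ?e (level N)"
      using p C(1) sub by (intro mult_left_mono powr_mono2 sum_mono2 sum_nonneg) auto
    finally show ?thesis by (simp add: M_def)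
  qed
  have "(\<lambda>N. C * ?e (level N)) \<longlonglongrightarrow> 0"
    by (intro tendsto_mult_right_zero filterlim_compose[OF block_dual_tendsto level_top])
  then have "(\<lambda>N. ?S N - ?S (2 ^ level N - 1)) \<longlonglongrightarrow> 0"
    by (rule Lim_null_comparison[OF always_eventually[OF allI[OF within]]])
  from tendsto_add[OF this filterlim_compose[OF blocks level_top]]
  show ?thesis by (simp add: sums_def)
qed

lemmas \<psi>_basis = biorthogonal_schauder_basis(1)[OF \<psi>_dual_functional \<psi>_biorthogonal \<psi>_sums]
lemmas coord_\<psi> = biorthogonal_schauder_basis(2)[OF \<psi>_dual_functional \<psi>_biorthogonal \<psi>_sums]

end

subsection \<open>Quasi-greediness and conditionality\<close>
context dyadic_basis
begin

lemma coord_proj_finite: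
  assumes "finite F" "\<And>j. j \<notin> F \<Longrightarrow> j \<in> A \<Longrightarrow> \<psi>_dual j f = 0"
  shows "coord_proj smul \<psi> A f = (\<Sum>j\<in>F. if j \<in> A then smul (\<psi>_dual j f) (\<psi> j) else 0)"
  unfolding coord_proj_def coord_\<psi> using assms by (intro suminf_finite) auto

lemma coord_proj_eqI:
  assumes "\<And>j. \<psi>_dual j g = (if j \<in> A then \<psi>_dual j f else 0)"
  shows "coord_proj smul \<psi> A f = g"
proof -
  have "(\<lambda>j. if j \<in> A then smul (\<psi>_dual j f) (\<psi> j) else 0) = (\<lambda>j. smul (\<psi>_dual j g) (\<psi> j))"
    by (auto simp: assms)
  then show ?thesis unfolding coord_proj_def coord_\<psi> using sums_unique[OF \<psi>_sums[of g]] by simp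
qed

lemma \<psi>_norm_bounds:
  "\<exists>c C. c > 0 \<and> (\<forall>j. c \<le> norm (\<psi> j) \<and> norm (\<psi> j) \<le> C)"
proof -
  obtain C where C: "C > 0" "\<And>f j. norm (\<psi>_dual j f) \<le> C * norm f" using \<psi>_dual_bound by blast
  obtain C' where C': "\<And>F a n. F \<subseteq> block n \<Longrightarrow>
     norm (\<Sum>j\<in>F. smul (a j) (\<psi> j)) \<le> C' * (\<Sum>j\<in>F. norm (a j) powr p) powr (1 / p)"
    using block_combination_bound by blast
  have "1 / C \<le> norm (\<psi> j)" for j
    using C(1) C(2)[of j "\<psi> j"] by (simp add: \<psi>_biorthogonal field_simps)
  moreover have "norm (\<psi> j) \<le> C'" for j
    using C'[of "{j}" "level j" "\<lambda>_. 1"] by (simp add: mem_block_iff)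
  ultimately show ?thesis using C(1) by (intro exI[of _ "1 / C"] exI[of _ C']) simp
qed

lemma \<psi>_dual_tendsto: "(\<lambda>j. \<psi>_dual j f) \<longlonglongrightarrow> 0"
proof -
  obtain c where c: "c > 0" "\<And>j. c \<le> norm (\<psi> j)" using \<psi>_norm_bounds by blast
  have lim: "(\<lambda>j. norm (smul (\<psi>_dual j f) (\<psi> j)) / c) \<longlonglongrightarrow> 0"
    by (intro tendsto_divide_zero tendsto_norm_zero summable_LIMSEQ_zero sums_summable[OF \<psi>_sums])
  have le: "norm (\<psi>_dual j f) \<le> norm (smul (\<psi>_dual j f) (\<psi> j)) / c" for j
    using c(1) mult_left_mono[OF c(2)[of j], of "norm (\<psi>_dual j f)"]
    by (simp add: norm_scale pos_le_divide_eq)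
  show ?thesis by (rule Lim_null_comparison[OF always_eventually[OF allI[OF le]] lim])
qed

text \<open>With \<open>t\<close> the least modulus of a chosen coefficient, the blocks split into low levels, where the
  discarded coefficients are at most \<open>t\<close> and contribute a geometric series, and high levels, where
  the block means are below \<open>t / 2\<close>, so that the chosen coefficients are controlled by the
  \<open>ell p\<close> part of \<open>f\<close>.\<close>

lemma greedy_remainder_bound:
  "\<exists>C. \<forall>f A. (\<forall>j\<in>-A. \<forall>k\<in>A. norm (\<psi>_dual j f) \<le> norm (\<psi>_dual k f)) \<longrightarrow>
      norm (f - coord_proj smul \<psi> A f) \<le> C * norm f"
proof -
  obtain C where C: "C > 0" "\<And>F a. finite F \<Longrightarrow> norm (\<Sum>j\<in>F. smul (a j) (\<psi> j)) \<le>
     C * (\<Sum>j\<in>F. weight p (level j) / 2 ^ level j * norm (a j)) + C * (\<Sum>j\<in>F. norm (a j) powr p) powr (1 / p)"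
    using combination_bound by blast
  obtain C1 where C1: "C1 > 0" "\<And>f n. weight p n * norm (\<alpha> n f) \<le> C1 * norm f"
      "\<And>f. ell_norm p (res (J f)) \<le> C1 * norm f"
    using parameter_bound by blast
  obtain K where K: "K \<ge> 0" "\<And>N f. norm (psum \<psi> N f) \<le> K * norm f"
    using psum_bounded[OF \<psi>_basis] by blast
  define r where "r = (2::real) powr (1 / p)"
  have r: "r > 1" using p by (simp add: r_def)
  \<comment> \<open>One summand for each of \<open>f\<close>, the partial sum, the two low and the
    two high estimates; \<open>2 * C1\<close> stands for \<open>2 * R\<close> divided by
    \<open>norm f\<close>.\<close>
  define C2 where "C2 = 1 + K + C * (r / (r - 1) * (2 * C1)) + C * (r * (2 * C1)) + C * (2 * C1) + C * (2 * C1)"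
  have C2: "C2 \<ge> 1"
    using C(1) C1(1) K(1) r by (simp add: C2_def)
  have "norm (f - coord_proj smul \<psi> A f) \<le> C2 * norm f"
    if greedy: "\<And>j k. j \<notin> A \<Longrightarrow> k \<in> A \<Longrightarrow> norm (\<psi>_dual j f) \<le> norm (\<psi>_dual k f)" for f A
  proof -
    \<comment> \<open>In the last case a nonzero coefficient is discarded. Since the coefficients
      tend to zero, \<open>A\<close> is then finite, and its least modulus \<open>t\<close> is
      attained and positive.\<close>
    consider "A = {}" | "\<And>j. j \<notin> A \<Longrightarrow> \<psi>_dual j f = 0"
      | j0 where "A \<noteq> {}" "j0 \<notin> A" "\<psi>_dual j0 f \<noteq> 0" by blast
    then show ?thesis
    proof cases
      case 1
      then have "coord_proj smul \<psi> A f = 0" by (simp add: coord_proj_def)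
      then show ?thesis using mult_right_mono[OF C2 norm_ge_zero[of f]] by simp
    next
      case 2
      then have "coord_proj smul \<psi> A f = f" by (intro coord_proj_eqI) auto
      then show ?thesis using C2 by simp
    next
      case 3
      let ?a = "\<lambda>j. \<psi>_dual j f"
      have "finite A"
      proof -
        have "\<forall>\<^sub>F j in sequentially. norm (?a j) < norm (?a j0)"
          using order_tendstoD(2)[OF tendsto_norm_zero[OF \<psi>_dual_tendsto]] 3(3) by simp
        then obtain M where "\<And>j. j \<ge> M \<Longrightarrow> norm (?a j) < norm (?a j0)"
          unfolding eventually_sequentially by blast
        then have "A \<subseteq> {..<M}" using greedy[OF 3(2)] by (meson lessThan_iff not_less subsetI)
        then show ?thesis using finite_subset by blast
      qed
      define t where "t = Min ((\<lambda>k. norm (?a k)) ` A)"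
      have t_le: "t \<le> norm (?a k)" if "k \<in> A" for k
        unfolding t_def using \<open>finite A\<close> that by (intro Min_le) auto
      obtain k0 where k0: "k0 \<in> A" "t = norm (?a k0)"
      proof -
        have "t \<in> (\<lambda>k. norm (?a k)) ` A"
          unfolding t_def using \<open>finite A\<close> 3(1) by (intro Min_in) auto
        then show thesis using that by blast
      qed
      have le_t: "norm (?a j) \<le> t" if "j \<notin> A" for j
        unfolding k0(2) by (rule greedy[OF that k0(1)])
      have t: "t > 0" using le_t[OF 3(2)] 3(3) by (meson less_le_trans zero_less_norm_iff)
      have f: "norm f > 0"
      proof -
        have "?a j0 \<noteq> 0" by (rule 3(3))
        then have "f \<noteq> 0" using coord_zero[OF \<psi>_basis, of j0] by (auto simp: coord_\<psi>)
        then show ?thesis by simp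
      qed
      define R where "R = C1 * norm f"
      have R: "R > 0" using C1(1) f by (simp add: R_def)
      \<comment> \<open>\<open>N\<close> is the first level at which \<open>R\<close>, a bound for
        \<open>weight p n * norm (\<alpha> n f)\<close>, forces the block mean below t / 2.\<close>
      obtain N where N: "2 * R < t * weight p N" "\<And>n. n < N \<Longrightarrow> t * weight p n \<le> 2 * R"
      proof -
        have "\<exists>n. 2 * R < t * weight p n"
        proof -
          obtain n where "2 * R / t < r ^ n" using real_arch_pow[OF r] by blast
          moreover have "weight p n = r ^ n"
            by (induction n) (simp_all add: weight_Suc r_def weight_def[of p 0])
          ultimately have "2 * R < t * weight p n" using t by (simp add: field_simps)
          then show ?thesis ..
        qed
        then show thesis using that[of "LEAST n. 2 * R < t * weight p n"]
          by (metis (mono_tags, lifting) LeastI_ex not_less_Least not_less)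
      qed
      define L where "L = {..<(2::nat) ^ N - 1}"
      let ?s = "\<lambda>F. \<Sum>j\<in>F. smul (?a j) (\<psi> j)"
      have fin: "finite L" by (simp add: L_def)
      have low: "norm (?s (L - A)) \<le> C * (r / (r - 1) * (2 * R)) + C * (r * (2 * R))"
      proof -
        have s: "(\<Sum>j\<in>L - A. weight p (level j) / 2 ^ level j * norm (?a j)) \<le> r / (r - 1) * (2 * R)"
          "(\<Sum>j\<in>L - A. norm (?a j) powr p) powr (1 / p) \<le> r * (2 * R)"
          unfolding r_def using R t N(2) le_t
          by (intro low_level_sums[OF p, where N = N and t = t]; auto simp: L_def)+
        have "C * (\<Sum>j\<in>L - A. weight p (level j) / 2 ^ level j * norm (?a j)) \<le> C * (r / (r - 1) * (2 * R))"
          "C * (\<Sum>j\<in>L - A. norm (?a j) powr p) powr (1 / p) \<le> C * (r * (2 * R))"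
          by (intro mult_left_mono s less_imp_le[OF C(1)])+
        then show ?thesis using C(2)[of "L - A" ?a] fin by fastforce
      qed
      have high: "norm (?s (A - L)) \<le> C * (2 * R) + C * (2 * R)"
      proof -
        have lev: "2 * R < t * weight p (level j)" if "j \<in> A - L" for j
        proof -
          have "N \<le> level j" using that level_less_iff[of j N] by (auto simp: L_def)
          then have "t * weight p N \<le> t * weight p (level j)"
            using t weight_mono[OF p_pos] by (intro mult_left_mono) auto
          then show ?thesis using N(1) by linarith
        qed
        have "t \<le> norm (?a j) \<and> norm (?a j) \<le> 2 * norm (res (J f) j)" if j: "j \<in> A - L" for j
        proof -
          have "weight p (level j) * norm (\<alpha> (level j) f) \<le> R" unfolding R_def by (rule C1(2))
          then have "weight p (level j) * (2 * norm (\<alpha> (level j) f)) < weight p (level j) * t"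
            using lev[OF j] by (simp add: mult.commute)
          then have "2 * norm (\<alpha> (level j) f) < t"
            using weight_pos[of p "level j"] by simp
          moreover have "norm (?a j) \<le> norm (\<alpha> (level j) f) + norm (res (J f) j)"
            by (simp add: \<psi>_dual_def norm_triangle_ineq)
          ultimately show ?thesis using t_le[of j] j by auto
        qed
        moreover have "(\<Sum>j\<in>A - L. norm (res (J f) j) powr p) \<le> R powr p"
          using order_trans[OF ell_sum_le[OF p_pos res_mem[OF J_mem]] powr_mono2[OF _ ell_norm_nonneg C1(3)]]
            p_pos \<open>finite A\<close> by (simp add: R_def)
        ultimately have s: "(\<Sum>j\<in>A - L. weight p (level j) / 2 ^ level j * norm (?a j)) \<le> 2 * R"
          "(\<Sum>j\<in>A - L. norm (?a j) powr p) powr (1 / p) \<le> 2 * R"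
          using high_level_sums[OF p R, of "A - L" t "\<lambda>j. norm (?a j)" "\<lambda>j. norm (res (J f) j)"] t lev by auto
        have "C * (\<Sum>j\<in>A - L. weight p (level j) / 2 ^ level j * norm (?a j)) \<le> C * (2 * R)"
          "C * (\<Sum>j\<in>A - L. norm (?a j) powr p) powr (1 / p) \<le> C * (2 * R)"
          by (intro mult_left_mono s less_imp_le[OF C(1)])+
        then show ?thesis using C(2)[of "A - L" ?a] \<open>finite A\<close> by fastforce
      qed
      \<comment> \<open>On the initial segment \<open>L\<close> the chosen coefficients can be
        large, so their sum is rewritten as a partial sum of \<open>f\<close> minus the sum of the
        discarded, small coefficients.\<close>
      have "coord_proj smul \<psi> A f = ?s A"
        using \<open>finite A\<close> by (subst coord_proj_finite[of A]) auto
      also have "\<dots> = ?s (A \<inter> L) + ?s (A - L)"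
        using \<open>finite A\<close> by (rule sum.Int_Diff)
      also have "?s (A \<inter> L) = ?s L - ?s (L - A)"
        unfolding sum.Int_Diff[OF fin, of _ A] Int_commute[of A L] by simp
      also have "?s L = psum \<psi> (2 ^ N - 1) f"
        by (simp add: psum_def coord_\<psi> L_def)
      finally have eq: "f - coord_proj smul \<psi> A f = f - psum \<psi> (2 ^ N - 1) f + ?s (L - A) - ?s (A - L)"
        by simp
      have "norm (f - coord_proj smul \<psi> A f)
          \<le> norm f + norm (psum \<psi> (2 ^ N - 1) f) + norm (?s (L - A)) + norm (?s (A - L))"
        unfolding eq using norm_triangle_ineq4[of "f - psum \<psi> (2 ^ N - 1) f + ?s (L - A)" "?s (A - L)"]
          norm_triangle_ineq[of "f - psum \<psi> (2 ^ N - 1) f" "?s (L - A)"]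
          norm_triangle_ineq4[of f "psum \<psi> (2 ^ N - 1) f"] by linarith
      also have "\<dots> \<le> norm f + K * norm f + (C * (r / (r - 1) * (2 * R)) + C * (r * (2 * R))) + (C * (2 * R) + C * (2 * R))"
        by (intro add_mono order_refl K(2) low high)
      also have "\<dots> = C2 * norm f" by (simp add: C2_def R_def algebra_simps)
      finally show ?thesis .
    qed
  qed
  then show ?thesis by (intro exI[of _ C2]) blast
qed

lemma \<psi>_quasi_greedy: "quasi_greedy_basis smul \<psi>"
proof -
  obtain c C where c: "c > 0" "\<And>j. c \<le> norm (\<psi> j)" and C: "\<And>j. norm (\<psi> j) \<le> C"
    using \<psi>_norm_bounds by blast
  have "c \<le> (INF j. norm (\<psi> j))" using c(2) by (intro cINF_greatest) auto
  moreover have "bdd_above (range (\<lambda>j. norm (\<psi> j)))" using C by (auto simp: bdd_above_def)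
  ultimately show ?thesis
    unfolding quasi_greedy_basis_def coord_\<psi> using \<psi>_basis c(1) greedy_remainder_bound by auto
qed

section \<open>The conditionality constants\<close>

definition ratios :: "nat \<Rightarrow> real set" where
  "ratios m = {norm (coord_proj smul \<psi> A f) / norm f | f A. f \<noteq> 0 \<and> supp smul \<psi> f \<subseteq> {..<m}}"

lemma w_cond_ratios: "w_cond smul \<psi> m = Sup (ratios m)"
  by (simp add: w_cond_def ratios_def)

text \<open>Each block contributes at most a constant times \<open>norm f\<close>, whatever
  \<open>A\<close> selects in it, and logarithmically many blocks cover
  \<open>{..<m}\<close>.\<close>

lemma ratios_le_log:
  "\<exists>C>0. \<forall>m\<ge>2. \<forall>x\<in>ratios m. x \<le> C * ln (real m)"
proof -
  obtain C where C: "C > 0" "\<And>F a n. F \<subseteq> block n \<Longrightarrow>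
     norm (\<Sum>j\<in>F. smul (a j) (\<psi> j)) \<le> C * (\<Sum>j\<in>F. norm (a j) powr p) powr (1 / p)"
    using block_combination_bound by blast
  obtain C' where C': "C' > 0" "\<And>f n. (\<Sum>j\<in>block n. norm (\<psi>_dual j f) powr p) powr (1 / p) \<le> C' * norm f"
    using block_dual_bound by blast
  have "norm (coord_proj smul \<psi> A f) / norm f \<le> C * C' * (3 / ln 2) * ln (real m)"
    if m: "m \<ge> 2" and f: "f \<noteq> 0" and supp: "supp smul \<psi> f \<subseteq> {..<m}" for m f A
  proof -
    define N where "N = Suc (level m)"
    have mN: "m < 2 ^ N - 1" using level_less_iff[of m N] by (simp add: N_def)
    have outside: "\<psi>_dual j f = 0" if "j \<notin> {..<2 ^ N - 1}" for j
      using that supp mN by (auto simp: supp_def coord_\<psi>)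
    have "coord_proj smul \<psi> A f = (\<Sum>j<2 ^ N - 1. if j \<in> A then smul (\<psi>_dual j f) (\<psi> j) else 0)"
      by (rule coord_proj_finite[OF finite_lessThan outside])
    also have "\<dots> = (\<Sum>n<N. \<Sum>j\<in>block n. if j \<in> A then smul (\<psi>_dual j f) (\<psi> j) else 0)"
      by (rule sum_lessThan_blocks)
    also have "norm \<dots> \<le> (\<Sum>n<N. C * C' * norm f)"
    proof (rule sum_norm_le)
      fix n
      have "(\<Sum>j\<in>block n. if j \<in> A then smul (\<psi>_dual j f) (\<psi> j) else 0)
          = (\<Sum>j\<in>block n \<inter> A. smul (\<psi>_dual j f) (\<psi> j))"
        by (simp add: sum.inter_restrict)
      then have "norm (\<Sum>j\<in>block n. if j \<in> A then smul (\<psi>_dual j f) (\<psi> j) else 0)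
          \<le> C * (\<Sum>j\<in>block n \<inter> A. norm (\<psi>_dual j f) powr p) powr (1 / p)"
        using C(2)[of "block n \<inter> A" n] by simp
      also have "\<dots> \<le> C * (\<Sum>j\<in>block n. norm (\<psi>_dual j f) powr p) powr (1 / p)"
        using p C(1) by (intro mult_left_mono powr_mono2 sum_mono2 sum_nonneg) auto
      also have "\<dots> \<le> C * (C' * norm f)" using C(1) by (intro mult_left_mono C') auto
      finally show "norm (\<Sum>j\<in>block n. if j \<in> A then smul (\<psi>_dual j f) (\<psi> j) else 0) \<le> C * C' * norm f"
        by simp
    qed
    finally have "norm (coord_proj smul \<psi> A f) / norm f \<le> C * C' * real N"
      using f by (simp add: field_simps)
    also have "real N \<le> 3 / ln 2 * ln (real m)"
    proof -
      \<comment> \<open>The 3 arises from m + 1 \<le> 2 m and from the \<open>Suc\<close> in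
        \<open>N\<close>: each costs one \<open>ln 2\<close>, which is at most
        \<open>ln (real m)\<close> for \<open>m \<ge> 2\<close>.\<close>
      have "2 ^ level m - 1 \<le> m" using level_less_iff[of m "level m"] by simp
      then have "2 ^ level m \<le> 2 * m" using m by linarith
      then have "(2::real) ^ level m \<le> 2 * real m" by (metis of_nat_le_iff of_nat_mult of_nat_numeral of_nat_power)
      then have "ln ((2::real) ^ level m) \<le> ln (2 * real m)" using m by simp
      then have "real (level m) * ln 2 \<le> ln 2 + ln (real m)" using m by (simp add: ln_realpow ln_mult)
      moreover have "ln 2 \<le> ln (real m)" using m by simp
      ultimately have "real N * ln 2 \<le> 3 * ln (real m)" by (simp add: N_def algebra_simps)
      then show ?thesis by (simp add: field_simps)
    qed
    finally show ?thesis using C(1) C'(1) by (simp add: mult_ac)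
  qed
  then show ?thesis
    using C(1) C'(1) by (intro exI[of _ "C * C' * (3 / ln 2)"]) (auto simp: ratios_def)
qed

lemma ratios_bdd: "m \<ge> 2 \<Longrightarrow> bdd_above (ratios m)"
  using ratios_le_log by (meson bdd_aboveI)

text \<open>Makes the supremum one over a nonempty set and at least 1, which absorbs additive
  constants in the lower estimate.\<close>

lemma one_in_ratios: "m \<ge> 1 \<Longrightarrow> 1 \<in> ratios m"
proof -
  assume m: "m \<ge> 1"
  have "\<psi> 0 \<noteq> 0" by (rule basis_vector_nonzero[OF \<psi>_basis])
  moreover have "coord_proj smul \<psi> UNIV (\<psi> 0) = \<psi> 0" by (rule coord_proj_eqI) simp
  moreover have "supp smul \<psi> (\<psi> 0) \<subseteq> {..<m}" using m by (auto simp: supp_def coord_\<psi> \<psi>_biorthogonal)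
  ultimately show ?thesis unfolding ratios_def by (intro CollectI exI[of _ "\<psi> 0"] exI[of _ UNIV]) auto
qed

text \<open>Vectors in the range of \<open>emb\<close> have no mean-zero part, so their coefficients
  are constant on blocks. Selecting whole blocks therefore amounts to selecting coordinates with
  respect to \<open>z\<close>.\<close>

lemma \<psi>_dual_emb: "\<psi>_dual j (emb g) = (1 / weight p (level j)) *\<^sub>R coord smul z (level j) g"
  by (simp add: \<psi>_dual_def \<alpha>_def ext_emb J_emb res_u)

lemma coord_z_sum: "coord smul z n (\<Sum>i<N. smul (\<beta> i) (z i)) = (if n < N then \<beta> n else 0)"
proof (rule coord_eqI[OF z])
  have "(\<lambda>n. smul (if n < N then \<beta> n else 0) (z n)) sums (\<Sum>n<N. smul (if n < N then \<beta> n else 0) (z n))"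
    by (rule sums_finite) auto
  then show "(\<lambda>n. smul (if n < N then \<beta> n else 0) (z n)) sums (\<Sum>i<N. smul (\<beta> i) (z i))" by simp
qed

text \<open>The bounded combination and its large part are moved by \<open>emb\<close>, and the
  index set \<open>A\<close> becomes the union of the blocks with level in \<open>A\<close>. Using
  \<open>2 * K\<close> vectors of \<open>z\<close> costs \<open>2 ^ (2 * K) - 1\<close> new
  vectors.\<close>

lemma linear_le_w_cond:
  assumes growth: "\<And>K. \<exists>\<beta> A. norm (\<Sum>n<2 * K. smul (\<beta> n) (z n)) \<le> M \<and>
       d * real K \<le> norm (\<Sum>n<2 * K. if n \<in> A then smul (\<beta> n) (z n) else 0)"
    and d: "d > 0"
  shows "\<exists>c>0. \<forall>m\<ge>2. \<forall>K. 2 ^ (2 * K) - 1 \<le> m \<longrightarrow> c * real K \<le> w_cond smul \<psi> m"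
proof -
  obtain Ke where Ke: "\<And>f. norm (emb f) \<le> norm f * Ke" "Ke > 0"
    using bounded_linear.pos_bounded[OF emb_linear] by blast
  obtain Kx where Kx: "\<And>f. norm (ext f) \<le> norm f * Kx" "Kx > 0"
    using bounded_linear.pos_bounded[OF ext_linear] by blast
  have M: "M \<ge> 0"
    using growth[of 0] norm_ge_zero order_trans by blast
  \<comment> \<open>\<open>Kx\<close> pays for recovering \<open>h\<close> from
    \<open>emb h\<close>, and \<open>(M + 1) * Ke\<close> bounds \<open>emb g\<close>; the 1 keeps
    the denominator positive when \<open>M = 0\<close>.\<close>
  define c where "c = d / (Kx * ((M + 1) * Ke))"
  have c: "c > 0" using d Kx(2) Ke(2) M by (simp add: c_def)
  have "c * real K \<le> w_cond smul \<psi> m" if m: "m \<ge> 2" and K: "2 ^ (2 * K) - 1 \<le> m" for m K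
  proof (cases "K = 0")
    case True
    have "1 \<le> w_cond smul \<psi> m"
      unfolding w_cond_ratios using m by (intro cSup_upper one_in_ratios ratios_bdd) auto
    then show ?thesis using True by simp
  next
    case False
    obtain \<beta> A where \<beta>: "norm (\<Sum>n<2 * K. smul (\<beta> n) (z n)) \<le> M"
       "d * real K \<le> norm (\<Sum>n<2 * K. if n \<in> A then smul (\<beta> n) (z n) else 0)"
      using growth by blast
    define g where "g = (\<Sum>n<2 * K. smul (\<beta> n) (z n))"
    define h where "h = (\<Sum>n<2 * K. smul (if n \<in> A then \<beta> n else 0) (z n))"
    have h: "d * real K \<le> norm h"
      using \<beta>(2) by (simp add: h_def if_distrib[of "\<lambda>c. smul c _"] cong: if_cong)
    have proj: "coord_proj smul \<psi> {j. level j \<in> A} (emb g) = emb h"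
      by (rule coord_proj_eqI) (simp add: \<psi>_dual_emb g_def h_def coord_z_sum)
    have "norm h > 0" using h d False by (meson less_le_trans mult_pos_pos of_nat_0_less_iff neq0_conv)
    moreover have "norm h \<le> norm (emb h) * Kx" using Kx(1)[of "emb h"] by (simp add: ext_emb)
    ultimately have "emb h \<noteq> 0" by auto
    have "emb g \<noteq> 0"
    proof
      assume "emb g = 0"
      then have "\<psi>_dual j (emb g) = 0" for j
        using coord_zero[OF \<psi>_basis, of j] by (simp add: coord_\<psi>)
      then have "coord_proj smul \<psi> {j. level j \<in> A} (emb g) = 0"
        unfolding coord_proj_def coord_\<psi> by (simp cong: if_cong)
      then show False using proj \<open>emb h \<noteq> 0\<close> by simp
    qed
    moreover have "supp smul \<psi> (emb g) \<subseteq> {..<m}"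
    proof
      fix j assume "j \<in> supp smul \<psi> (emb g)"
      then have "level j < 2 * K"
        by (auto simp: supp_def coord_\<psi> \<psi>_dual_emb g_def coord_z_sum split: if_splits)
      then show "j \<in> {..<m}" using K by (simp add: level_less_iff)
    qed
    ultimately have "norm (emb h) / norm (emb g) \<in> ratios m"
      unfolding ratios_def mem_Collect_eq using proj by metis
    then have "norm (emb h) / norm (emb g) \<le> w_cond smul \<psi> m"
      unfolding w_cond_ratios using m by (intro cSup_upper ratios_bdd) auto
    moreover have "c * real K \<le> norm (emb h) / norm (emb g)"
    proof -
      have "d * real K / Kx \<le> norm (emb h)"
        using h \<open>norm h \<le> norm (emb h) * Kx\<close> Kx(2) by (simp add: field_simps)
      moreover have "norm (emb g) \<le> (M + 1) * Ke"
        using order_trans[OF Ke(1) mult_right_mono[of "norm g" "M + 1" Ke]] \<beta>(1) Ke(2) by (simp add: g_def)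
      moreover have "norm (emb g) > 0" using \<open>emb g \<noteq> 0\<close> by simp
      ultimately have "(d * real K / Kx) / ((M + 1) * Ke) \<le> norm (emb h) / norm (emb g)"
        using d Kx(2) by (intro frac_le) auto
      then show ?thesis by (simp add: c_def)
    qed
    ultimately show ?thesis by linarith
  qed
  then show ?thesis using c by blast
qed

lemma w_cond_equivalent_log:
  assumes growth: "\<And>K. \<exists>\<beta> A. norm (\<Sum>n<2 * K. smul (\<beta> n) (z n)) \<le> M \<and>
       d * real K \<le> norm (\<Sum>n<2 * K. if n \<in> A then smul (\<beta> n) (z n) else 0)"
    and d: "d > 0"
  shows "equivalent_on {2..} (w_cond smul \<psi>) (\<lambda>m. ln (real m))"
proof -
  obtain C where C: "\<And>m x. m \<ge> 2 \<Longrightarrow> x \<in> ratios m \<Longrightarrow> x \<le> C * ln (real m)"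
    using ratios_le_log by blast
  have "w_cond smul \<psi> m \<le> C * ln (real m)" if "m \<ge> 2" for m
    unfolding w_cond_ratios using C[OF that] one_in_ratios[of m] that by (intro cSup_least) auto
  then have 1: "dominated_on {2..} (w_cond smul \<psi>) (\<lambda>m. ln (real m))"
    unfolding dominated_on_def by auto
  obtain c where c: "c > 0" "\<And>m K. m \<ge> 2 \<Longrightarrow> 2 ^ (2 * K) - 1 \<le> m \<Longrightarrow> c * real K \<le> w_cond smul \<psi> m"
    using linear_le_w_cond[OF growth d] by blast
  have "ln (real m) \<le> (2 / c + 2) * w_cond smul \<psi> m" if m: "m \<ge> 2" for m
  proof -
    \<comment> \<open>The largest \<open>K\<close> with \<open>2 * K \<le> level m\<close>, so that
      the first \<open>2 * K\<close> blocks fit. In \<open>ln (real m) \<le> 2 * real K + 2\<close>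
      the first term gives \<open>2 / c\<close>, and the remaining 2 is absorbed by the lower bound
      1 on \<open>w_cond\<close>.\<close>
    define K where "K = level m div 2"
    have "\<not> level m < 2 * K" by (simp add: K_def)
    then have "2 ^ (2 * K) - 1 \<le> m" unfolding level_less_iff by simp
    then have "real K \<le> w_cond smul \<psi> m / c" using c(2)[OF m] c(1) by (simp add: field_simps)
    moreover have "1 \<le> w_cond smul \<psi> m"
      unfolding w_cond_ratios using m by (intro cSup_upper one_in_ratios ratios_bdd) auto
    moreover have "ln (real m) \<le> 2 * real K + 2"
    proof -
      have "m < 2 ^ Suc (level m) - 1" using level_less_iff[of m "Suc (level m)"] by simp
      also have "(2::nat) ^ Suc (level m) - 1 \<le> 2 ^ (2 * K + 2)"
        unfolding K_def by (intro order_trans[OF diff_le_self] power_increasing) auto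
      finally have "real m \<le> 2 ^ (2 * K + 2)" by (metis less_imp_le of_nat_le_iff of_nat_numeral of_nat_power)
      then have "ln (real m) \<le> ln ((2::real) ^ (2 * K + 2))" using m by simp
      also have "\<dots> = real (2 * K + 2) * ln 2" by (rule ln_realpow)
      also have "\<dots> \<le> real (2 * K + 2) * 1" using ln_2_less_1 by (intro mult_left_mono) auto
      finally show ?thesis by simp
    qed
    ultimately have "ln (real m) \<le> 2 * (w_cond smul \<psi> m / c) + 2 * w_cond smul \<psi> m" by linarith
    then show ?thesis by (simp add: distrib_right)
  qed
  then have 2: "dominated_on {2..} (\<lambda>m. ln (real m)) (w_cond smul \<psi>)"
    unfolding dominated_on_def by (intro exI[of _ "2 / c + 2"]) simp
  show ?thesis unfolding equivalent_on_def using 1 2 by blast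
qed

end

theorem theorem3p11:
  fixes smul :: "'k::real_or_complex_field \<Rightarrow> 'a::banach \<Rightarrow> 'a"
    and p :: real
  assumes "banach_space_over smul"
    and "1 < p"
    and "isomorphic_to_complemented_subspace (ell p) (ell_norm p) smul"
    and "isomorphic_to_complemented_subspace c_null c_null_norm smul"
    and "\<exists>y. schauder_basis smul y"
  shows "\<exists>x. quasi_greedy_basis smul x \<and>
           equivalent_on {2..} (w_cond smul x) (\<lambda>m. ln (real m))"
proof -
  interpret banach_space_over smul by fact
  have p: "p > 0" using assms(2) by simp
  obtain T J where "complemented_copy smul (ell p) (ell_norm p) T J"
    using complemented_copy_exists[OF assms(3) ell_add[OF p] ell_scale ell_norm_nonneg] by blast
  then interpret absorbed_summand smul "ell p" "ell_norm p" T J "dyadic_spread p" "dyadic_mean p"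
    by (rule absorbed_summand_ell[OF assms(2)])
  obtain z B M d where z: "schauder_basis smul z" "B > 0" "\<And>n. norm (z n) \<le> B"
    "\<And>n f. norm (coord smul z n f) \<le> B * norm f" and d: "d > 0"
    and growth: "\<And>K. \<exists>\<beta> A. norm (\<Sum>n<2 * K. smul (\<beta> n) (z n)) \<le> M \<and>
       d * real K \<le> norm (\<Sum>n<2 * K. if n \<in> A then smul (\<beta> n) (z n) else 0)"
    using conditional_basis_exists[OF assms(4,5)] by blast
  interpret dyadic_basis smul p T J z B
    by unfold_locales (use assms(2) z in auto)
  show ?thesis
    using \<psi>_quasi_greedy w_cond_equivalent_log[OF growth d] by blast
qed

end
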